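(* Assume (A1)–(A6) of the context, let $0<t<\frac{1}{2\rho}$, and let $\{x_{i,k}\}$ be the sequence generated by the distributed projected stochastic subgradient method $x_{i,k+1}=\mathrm{Proj}_{\mathcal X}(v_{i,k}-\alpha_k\xi_{i,k})$. Then $$\lim_{T\to\infty}\ \inf_{k\le T}\ \mathbb E\|\nabla\varphi_t(\bar x_k)\|=0 .$$
   Context: Problem: $\min_{x\in\mathcal X} f(x)=\frac1N\sum_{i=1}^N f_i(x)$, where $\mathcal X\subset\mathbb{R}^n$ is a (nonempty) closed convex set and $f_i:\mathbb{R}^n\to\mathbb{R}$ is the objective of agent $i\in\mathcal V=\{1,\dots,N\}$. $\|\cdot\|$ is the Euclidean norm, $\mathrm{Proj}_{\mathcal X}$ the orthogonal projection onto $\mathcal X$. Weak convexity: $f_i$ is $\rho$-weakly convex ($\rho>0$) if $f_i=h_i-\frac{\rho}{2}\|\cdot\|^2$ for some convex $h_i$; then $\partial f_i(x):=\partial h_i(x)-\rho x$, with $\partial h_i$ the convex subdifferential. Network: at each time $k\ge0$, $(\mathcal V,E_k)$ is a directed graph and $A(k)=[a_{i,j}(k)]$ is an $N\times N$ (deterministic) matrix of nonnegative weights, where $a_{i,j}(k)$ is the weight agent $i$ gives to the information received from agent $j$, and $(j,i)\in E_k$ iff $a_{i,j}(k)>0$. $\mathcal N_i(k)=\{j: a_{i,j}(k)>0\}$. Algorithm: initial points $x_{i,0}\in\mathcal X$; $v_{i,k}=\sum_{j\in\mathcal N_i(k)}a_{i,j}(k)x_{j,k}$; $x_{i,k+1}=\mathrm{Proj}_{\mathcal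 X}(v_{i,k}-\alpha_k\xi_{i,k})$, where $\alpha_k>0$ is the stepsize and $\xi_{i,k}$ is a random vector with $\mathbb E[\xi_{i,k}\mid\mathcal F_k]\in\partial f_i(v_{i,k})$, $\mathcal F_k$ being the history up to the computation of the iterates $x_{1,k},\dots,x_{N,k}$, and $\mathbb E\|\xi_{i,k}\|^2\le L^2$ for all $i,k$ (same $L$ as in (A5)). Average: $\bar x_k=\frac1N\sum_{i=1}^N x_{i,k}$. Assumptions: (A1) There is $\eta\in(0,1)$ such that for all $i,j$ and $k\ge0$: $a_{i,i}(k)\ge\eta$, and $a_{i,j}(k)>0$ implies $a_{i,j}(k)\ge\eta$. (A2) Each $A(k)$ is doubly stochastic. (A3) The graph $(\mathcal V,E_\infty)$ is strongly connected, where $E_\infty=\{(j,i):(j,i)\in E_k\text{ for infinitely many }k\}$. (A4) There is an integer $T_0\ge1$ such that for every $(j,i)\in E_\infty$ and every $k\ge0$, $(j,i)\in E_k\cup E_{k+1}\cup\dots\cup E_{k+T_0-1}$. (A5) $f$ is bounded below; every $f_i$ is $\rho$-weakly convex; and every element of $\partial f_i(x)$ has norm at most $L$, for all $x\in\mathcal X$ and all $i$. (A6) $\alpha_k>0$, $\sum_{k=0}^\infty\alpha_k=\infty$, $\lim_{k\to\infty}\alpha_k=0$, $\lim_{k\to\infty}\alpha_{k+1}/\alpha_k=1$. Moreau envelope: $\varphi(x)=f(x)+\mathbb I_{\mathcal X}(x)$, with $\mathbb I_{\mathcal X}=0$ on $\mathcal X$ and $+\infty$ elsewhere, and $\varphi_t(x)=\min_{y\in\mathbb{R}^n}\{\varphi(y)+\frac1{2t}\|y-x\|^2\}$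 for $0<t<1/\rho$; $\varphi_t$ is $C^1$ and $\|\nabla\varphi_t(x)\|=\frac1t\|\hat x-x\|$ with $\hat x$ the unique minimizer. *)

theory Defs
  imports "HOL-Probability.Probability"
begin

section \<open>Weak convexity and subdifferentials\<close>

definition convex_subdifferential ::
    "('a::euclidean_space \<Rightarrow> real) \<Rightarrow> 'a \<Rightarrow> 'a set" where
  "convex_subdifferential h x = {g. \<forall>y. h y \<ge> h x + g \<bullet> (y - x)}"

definition weakly_convex :: "real \<Rightarrow> ('a::euclidean_space \<Rightarrow> real) \<Rightarrow> bool" where
  "weakly_convex \<rho> f \<longleftrightarrow>
     (\<exists>h. convex_on UNIV h \<and> f = (\<lambda>x. h x - \<rho> / 2 * (norm x)\<^sup>2))"

text \<open>For a weakly convex \<open>f\<close> the convex function \<open>h\<close> with \<open>f = h - \<rho>/2 * norm\<^sup>2\<close> is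
  determined by \<open>f\<close> and \<open>\<rho>\<close>, namely \<open>h = f + \<rho>/2 * norm\<^sup>2\<close>.\<close>

definition subdifferential ::
    "real \<Rightarrow> ('a::euclidean_space \<Rightarrow> real) \<Rightarrow> 'a \<Rightarrow> 'a set" where
  "subdifferential \<rho> f x =
     (\<lambda>g. g - \<rho> *\<^sub>R x) ` convex_subdifferential (\<lambda>y. f y + \<rho> / 2 * (norm y)\<^sup>2) x"

section \<open>Moreau envelope of the constrained objective\<close>

definition convex_indicator :: "'a set \<Rightarrow> 'a \<Rightarrow> ereal" where
  "convex_indicator X x = (if x \<in> X then 0 else \<infinity>)"

definition constrained_objective :: "('a \<Rightarrow> real) \<Rightarrow> 'a set \<Rightarrow> 'a \<Rightarrow> ereal" where
  "constrained_objective f X x = ereal (f x) + convex_indicator X x"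

text \<open>The infimum is attained and finite in the situation where it is used, so that the
  conversion to a real number loses nothing.\<close>

definition moreau_envelope ::
    "real \<Rightarrow> ('a::euclidean_space \<Rightarrow> ereal) \<Rightarrow> 'a \<Rightarrow> real" where
  "moreau_envelope t \<phi> x =
     real_of_ereal (INF y. \<phi> y + ereal (1 / (2 * t) * (norm (y - x))\<^sup>2))"

definition gradient :: "('a::euclidean_space \<Rightarrow> real) \<Rightarrow> 'a \<Rightarrow> 'a" where
  "gradient g x = (THE D. GDERIV g x :> D)"

section \<open>The time-varying network\<close>

text \<open>\<open>A k i j\<close> is the weight that agent \<open>i\<close> gives at time \<open>k\<close> to the information received
  from agent \<open>j\<close>; it corresponds to the edge \<open>(j, i)\<close>, from sender to receiver.\<close>

definition edges :: "(nat \<Rightarrow> 'v \<Rightarrow> 'v \<Rightarrow> real) \<Rightarrow> nat \<Rightarrow> ('v \<times> 'v) set" where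
  "edges A k = {(j, i). A k i j > 0}"

definition in_neighbours :: "(nat \<Rightarrow> 'v \<Rightarrow> 'v \<Rightarrow> real) \<Rightarrow> nat \<Rightarrow> 'v \<Rightarrow> 'v set" where
  "in_neighbours A k i = {j. A k i j > 0}"

definition edges_inf :: "(nat \<Rightarrow> 'v \<Rightarrow> 'v \<Rightarrow> real) \<Rightarrow> ('v \<times> 'v) set" where
  "edges_inf A = {e. infinite {k. e \<in> edges A k}}"

definition strongly_connected :: "('v \<times> 'v) set \<Rightarrow> bool" where
  "strongly_connected E \<longleftrightarrow> (\<forall>u w. (u, w) \<in> E\<^sup>*)"

definition doubly_stochastic :: "('v::finite \<Rightarrow> 'v \<Rightarrow> real) \<Rightarrow> bool" where
  "doubly_stochastic W \<longleftrightarrow>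
     (\<forall>i j. W i j \<ge> 0) \<and> (\<forall>i. (\<Sum>j\<in>UNIV. W i j) = 1) \<and> (\<forall>j. (\<Sum>i\<in>UNIV. W i j) = 1)"

definition average :: "('v::finite \<Rightarrow> 'b::real_vector) \<Rightarrow> 'b" where
  "average z = (1 / real CARD('v)) *\<^sub>R (\<Sum>i\<in>UNIV. z i)"

section \<open>Conditional expectation of random vectors\<close>

text \<open>The library only provides real-valued conditional expectations; for vectors they are
  taken coordinatewise.\<close>

definition vec_cond_exp ::
    "'w measure \<Rightarrow> 'w measure \<Rightarrow> ('w \<Rightarrow> 'a::euclidean_space) \<Rightarrow> 'w \<Rightarrow> 'a" where
  "vec_cond_exp M F Y \<omega> = (\<Sum>b\<in>Basis. real_cond_exp M F (\<lambda>\<omega>'. Y \<omega>' \<bullet> b) \<omega> *\<^sub>R b)"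

section \<open>The distributed projected stochastic subgradient method\<close>

definition mixed ::
    "(nat \<Rightarrow> 'v::finite \<Rightarrow> 'v \<Rightarrow> real) \<Rightarrow> ('v \<Rightarrow> nat \<Rightarrow> 'w \<Rightarrow> 'a::real_vector)
      \<Rightarrow> 'v \<Rightarrow> nat \<Rightarrow> 'w \<Rightarrow> 'a" where
  "mixed A x i k \<omega> = (\<Sum>j\<in>in_neighbours A k i. A k i j *\<^sub>R x j k \<omega>)"

text \<open>\<open>F k\<close> is the history up to the computation of the iterates \<open>x i k\<close>. Any filtration
  to which the iterates are adapted is allowed, in particular the one generated by the
  iterates up to time \<open>k\<close> and the noise before time \<open>k\<close>. The initial points are
  \<open>F 0\<close>-measurable; deterministic ones are the special case of constant functions.\<close>

definition stochastic_subgradient_method ::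
    "'w measure \<Rightarrow> (nat \<Rightarrow> 'w measure) \<Rightarrow> 'a::euclidean_space set \<Rightarrow> real \<Rightarrow> real
      \<Rightarrow> ('v::finite \<Rightarrow> 'a \<Rightarrow> real) \<Rightarrow> (nat \<Rightarrow> 'v \<Rightarrow> 'v \<Rightarrow> real) \<Rightarrow> (nat \<Rightarrow> real)
      \<Rightarrow> ('v \<Rightarrow> nat \<Rightarrow> 'w \<Rightarrow> 'a) \<Rightarrow> ('v \<Rightarrow> nat \<Rightarrow> 'w \<Rightarrow> 'a) \<Rightarrow> bool" where
  "stochastic_subgradient_method M F X \<rho> L f A \<alpha> \<xi> x \<longleftrightarrow>
     filtration (space M) F \<and> (\<forall>k. subalgebra M (F k)) \<and>
     (\<forall>i k. x i k \<in> borel_measurable (F k)) \<and>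
     (\<forall>i k. \<xi> i k \<in> borel_measurable M) \<and>
     (\<forall>i k. integrable M (\<lambda>\<omega>. (norm (\<xi> i k \<omega>))\<^sup>2) \<and>
            (\<integral>\<omega>. (norm (\<xi> i k \<omega>))\<^sup>2 \<partial>M) \<le> L\<^sup>2) \<and>
     (\<forall>i k. AE \<omega> in M.
            vec_cond_exp M (F k) (\<xi> i k) \<omega> \<in> subdifferential \<rho> (f i) (mixed A x i k \<omega>)) \<and>
     (\<forall>i. \<forall>\<omega>\<in>space M. x i 0 \<omega> \<in> X) \<and>
     (\<forall>i k. \<forall>\<omega>\<in>space M.
            x i (Suc k) \<omega> = closest_point X (mixed A x i k \<omega> - \<alpha> k *\<^sub>R \<xi> i k \<omega>))"

end

theory Submission
  imports Defs
begin

text \<open>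
  The Moreau envelope \<open>\<phi>\<^sub>t\<close> serves as a Lyapunov function. Let \<open>p\<close> be the proximal point of the
  average iterate \<open>xbar\<close> at time \<open>k\<close>, and let \<open>v i\<close> be the mixed points. Inserting \<open>p\<close> into the
  envelope at the next average, and using that the projection is nonexpansive and the weights are
  doubly stochastic, bounds the increase of \<open>\<phi>\<^sub>t\<close> by the average of
  \<open>(\<alpha> / t) * ((p - v i) \<bullet> \<xi> i)\<close> plus the consensus error and a term of order \<open>\<alpha>\<^sup>2\<close>
  (lemma \<open>env_step\<close>). In conditional mean \<open>\<xi> i\<close> is a subgradient of a weakly convex function, and
  \<open>p\<close> minimizes the proximal objective; hence \<open>\<alpha>\<close> times the average of the
  \<open>(p - v i) \<bullet> \<xi> i\<close> is in conditional mean at most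
  \<open>- (1 / t - \<rho>) / 2 * \<alpha> * (norm (p - xbar))\<^sup>2\<close>, again up to the consensus error and a term of
  order \<open>\<alpha>\<^sup>2\<close> (lemmas \<open>subgradient_inner_le\<close> and \<open>expected_descent\<close>). Since
  \<open>norm (p - xbar) = t * norm (gradient \<phi>\<^sub>t xbar)\<close>, this is a descent in terms of the gradient.

  Summed over time, the consensus error is at most of the order of \<open>\<Sum> \<alpha>\<^sup>2\<close>. Over a window of fixed length
  the product of the weight matrices has all entries at least \<open>\<eta> ^ m\<close>, because information
  travels along the recurrent edges and self-loops preserve it
  (\<open>transition_uniformly_positive\<close>). Such a doubly stochastic matrix contracts the dispersion
  around the average, so the dispersion satisfies a contraction perturbed by squared stepsizes
  (\<open>dispersion_perturbed_averaging\<close>). Summing everything, \<open>\<Sum> \<alpha> * D\<close> is bounded by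
  a constant plus a multiple of \<open>\<Sum> \<alpha>\<^sup>2\<close>, which is negligible against \<open>\<Sum> \<alpha> = \<infinity>\<close>;
  so the mean square distances \<open>D\<close> of \<open>xbar\<close> and \<open>p\<close> cannot stay away from \<open>0\<close> (\<open>descent_exists_small\<close>).

  The initial points need not have any moments. The argument is therefore run with expectations
  restricted to the event that the initial points are bounded by a constant, which belongs to the
  initial history. As the gradient of the envelope is bounded on \<open>X\<close>, the complementary event
  contributes arbitrarily little (\<open>exists_small_distance\<close>).
\<close>

section \<open>Consensus under perturbed averaging\<close>

lemma norm_weighted_sum_sq_le:
  fixes y :: "'v \<Rightarrow> 'a::real_inner"
  assumes "\<And>j. j \<in> I \<Longrightarrow> w j \<ge> 0"
  shows "(norm (\<Sum>j\<in>I. w j *\<^sub>R y j))\<^sup>2 \<le> (\<Sum>j\<in>I. w j) * (\<Sum>j\<in>I. w j * (norm (y j))\<^sup>2)"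
proof -
  have "norm (\<Sum>j\<in>I. w j *\<^sub>R y j) \<le> (\<Sum>j\<in>I. w j * norm (y j))"
    by (rule order_trans[OF norm_sum]) (use assms in \<open>auto intro!: sum_mono\<close>)
  hence "(norm (\<Sum>j\<in>I. w j *\<^sub>R y j))\<^sup>2 \<le> (\<Sum>j\<in>I. w j * norm (y j))\<^sup>2"
    by (simp add: power_mono)
  also have "(\<Sum>j\<in>I. w j * norm (y j)) = (\<Sum>j\<in>I. sqrt (w j) * (sqrt (w j) * norm (y j)))"
    by (rule sum.cong) (use assms in \<open>auto simp flip: mult.assoc\<close>)
  also have "(\<Sum>j\<in>I. sqrt (w j) * (sqrt (w j) * norm (y j)))\<^sup>2
      \<le> (\<Sum>j\<in>I. (sqrt (w j))\<^sup>2) * (\<Sum>j\<in>I. (sqrt (w j) * norm (y j))\<^sup>2)"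
    by (rule Cauchy_Schwarz_ineq_sum)
  also have "\<dots> = (\<Sum>j\<in>I. w j) * (\<Sum>j\<in>I. w j * (norm (y j))\<^sup>2)"
    using assms by (simp add: power_mult_distrib cong: sum.cong)
  finally show ?thesis .
qed

lemma norm_add_sq_le:
  fixes x y :: "'a::real_inner"
  assumes "c > 0"
  shows "(norm (x + y))\<^sup>2 \<le> (1 + c) * (norm x)\<^sup>2 + (1 + 1 / c) * (norm y)\<^sup>2"
proof -
  have "2 * (x \<bullet> y) \<le> c * (norm x)\<^sup>2 + (1 / c) * (norm y)\<^sup>2"
  proof -
    have "0 \<le> (norm (c *\<^sub>R x - y))\<^sup>2" by simp
    also have "\<dots> = c\<^sup>2 * (norm x)\<^sup>2 - 2 * c * (x \<bullet> y) + (norm y)\<^sup>2"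
      by (simp add: power2_norm_eq_inner inner_diff_left inner_diff_right inner_commute)
        (simp add: power2_eq_square algebra_simps)
    finally have "2 * c * (x \<bullet> y) \<le> c\<^sup>2 * (norm x)\<^sup>2 + (norm y)\<^sup>2" by simp
    thus ?thesis using assms by (simp add: field_simps power2_eq_square)
  qed
  thus ?thesis
    by (simp add: power2_norm_eq_inner inner_add inner_commute algebra_simps)
qed

lemma norm_add_sq_le2:
  fixes x y :: "'a::real_inner"
  shows "(norm (x + y))\<^sup>2 \<le> 2 * (norm x)\<^sup>2 + 2 * (norm y)\<^sup>2"
  using norm_add_sq_le[of 1 x y] by simp

text \<open>The total squared deviation from the average, summed (not averaged) over the agents.\<close>

definition dispersion :: "('v::finite \<Rightarrow> 'a::real_inner) \<Rightarrow> real" where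
  "dispersion z = (\<Sum>i\<in>UNIV. (norm (z i - average z))\<^sup>2)"

lemma dispersion_nonneg: "dispersion z \<ge> 0"
  by (simp add: dispersion_def sum_nonneg)

lemma average_add: "average (\<lambda>i. y i + z i) = average y + average z"
  by (simp add: average_def sum.distrib scaleR_add_right)

lemma sum_deviation_eq_0:
  fixes z :: "'v::finite \<Rightarrow> 'a::real_inner"
  shows "(\<Sum>i\<in>UNIV. z i - average z) = 0"
  by (simp add: sum_subtractf average_def sum_constant_scaleR)

text \<open>The bias-variance decomposition.\<close>

lemma sum_norm_sq_shift:
  fixes z :: "'v::finite \<Rightarrow> 'a::real_inner"
  shows "(\<Sum>i\<in>UNIV. (norm (z i - p))\<^sup>2)
    = dispersion z + real CARD('v) * (norm (average z - p))\<^sup>2"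
proof -
  have "(norm (z i - p))\<^sup>2 = (norm (z i - average z))\<^sup>2
      + 2 * ((z i - average z) \<bullet> (average z - p)) + (norm (average z - p))\<^sup>2" for i
    by (simp add: power2_norm_eq_inner inner_diff inner_commute algebra_simps)
  hence "(\<Sum>i\<in>UNIV. (norm (z i - p))\<^sup>2) = dispersion z
      + 2 * ((\<Sum>i\<in>UNIV. z i - average z) \<bullet> (average z - p))
      + real CARD('v) * (norm (average z - p))\<^sup>2"
    by (simp add: sum.distrib dispersion_def inner_sum_left sum_distrib_left)
  thus ?thesis by (simp add: sum_deviation_eq_0)
qed

lemma dispersion_le_sum_norm_sq:
  fixes z :: "'v::finite \<Rightarrow> 'a::real_inner"
  shows "dispersion z \<le> (\<Sum>i\<in>UNIV. (norm (z i))\<^sup>2)"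
  using sum_norm_sq_shift[of z 0] by simp

lemma dispersion_add_le:
  assumes "c > 0"
  shows "dispersion (\<lambda>i. y i + z i) \<le> (1 + c) * dispersion y + (1 + 1 / c) * dispersion z"
proof -
  have "(norm (y i + z i - average (\<lambda>i. y i + z i)))\<^sup>2
    \<le> (1 + c) * (norm (y i - average y))\<^sup>2 + (1 + 1 / c) * (norm (z i - average z))\<^sup>2" for i
    using norm_add_sq_le[OF assms, of "y i - average y" "z i - average z"]
    by (simp add: average_add algebra_simps)
  hence "dispersion (\<lambda>i. y i + z i) \<le> (\<Sum>i\<in>UNIV. (1 + c) * (norm (y i - average y))\<^sup>2
      + (1 + 1 / c) * (norm (z i - average z))\<^sup>2)"
    unfolding dispersion_def by (intro sum_mono) auto
  also have "\<dots> = (1 + c) * dispersion y + (1 + 1 / c) * dispersion z"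
    by (simp add: dispersion_def sum.distrib sum_distrib_left)
  finally show ?thesis .
qed

lemma average_doubly_stochastic:
  fixes z :: "'v::finite \<Rightarrow> 'a::real_vector"
  assumes "doubly_stochastic W"
  shows "average (\<lambda>i. \<Sum>j\<in>UNIV. W i j *\<^sub>R z j) = average z"
proof -
  have "(\<Sum>i\<in>UNIV. \<Sum>j\<in>UNIV. W i j *\<^sub>R z j) = (\<Sum>j\<in>UNIV. (\<Sum>i\<in>UNIV. W i j) *\<^sub>R z j)"
    by (subst sum.swap) (simp add: scaleR_sum_left)
  thus ?thesis using assms by (simp add: average_def doubly_stochastic_def)
qed

text \<open>A doubly stochastic matrix with all entries at least \<open>\<delta>\<close> acts on deviations from the
  average as the matrix with entries \<open>W i j - \<delta>\<close>, whose rows and columns sum to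
  \<open>1 - N\<delta>\<close>.\<close>

lemma dispersion_doubly_stochastic_contract:
  fixes z :: "'v::finite \<Rightarrow> 'a::real_inner"
  assumes W: "doubly_stochastic W" and \<delta>: "\<And>i j. W i j \<ge> \<delta>"
  shows "dispersion (\<lambda>i. \<Sum>j\<in>UNIV. W i j *\<^sub>R z j)
    \<le> (1 - real CARD('v) * \<delta>)\<^sup>2 * dispersion z"
proof -
  let ?\<theta> = "1 - real CARD('v) * \<delta>"
  let ?d = "\<lambda>j. z j - average z"
  have rows: "(\<Sum>j\<in>UNIV. W i j) = 1" and cols: "(\<Sum>i\<in>UNIV. W i j) = 1" for i j
    using W by (auto simp: doubly_stochastic_def)
  have dev: "(\<Sum>j\<in>UNIV. W i j *\<^sub>R z j) - average z = (\<Sum>j\<in>UNIV. (W i j - \<delta>) *\<^sub>R ?d j)" for i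
  proof -
    have "(\<Sum>j\<in>UNIV. (W i j - \<delta>) *\<^sub>R ?d j)
        = (\<Sum>j\<in>UNIV. W i j *\<^sub>R ?d j) - \<delta> *\<^sub>R (\<Sum>j\<in>UNIV. ?d j)"
      by (subst scaleR_sum_right) (simp add: scaleR_diff_left flip: sum_subtractf)
    also have "\<dots> = (\<Sum>j\<in>UNIV. W i j *\<^sub>R z j) - (\<Sum>j\<in>UNIV. W i j) *\<^sub>R average z"
      by (simp only: sum_deviation_eq_0) (simp add: scaleR_diff_right sum_subtractf scaleR_sum_left)
    finally show ?thesis by (simp add: rows)
  qed
  have "dispersion (\<lambda>i. \<Sum>j\<in>UNIV. W i j *\<^sub>R z j)
      = (\<Sum>i\<in>UNIV. (norm (\<Sum>j\<in>UNIV. (W i j - \<delta>) *\<^sub>R ?d j))\<^sup>2)"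
    by (simp add: dispersion_def average_doubly_stochastic[OF W] dev)
  also have "\<dots> \<le> (\<Sum>i\<in>UNIV. (\<Sum>j\<in>UNIV. W i j - \<delta>) * (\<Sum>j\<in>UNIV. (W i j - \<delta>) * (norm (?d j))\<^sup>2))"
    by (intro sum_mono norm_weighted_sum_sq_le) (use \<delta> in auto)
  also have "\<dots> = ?\<theta> * (\<Sum>i\<in>UNIV. \<Sum>j\<in>UNIV. (W i j - \<delta>) * (norm (?d j))\<^sup>2)"
    by (simp add: sum_subtractf rows sum_distrib_left)
  also have "(\<Sum>i\<in>UNIV. \<Sum>j\<in>UNIV. (W i j - \<delta>) * (norm (?d j))\<^sup>2)
      = (\<Sum>j\<in>UNIV. (\<Sum>i\<in>UNIV. W i j - \<delta>) * (norm (?d j))\<^sup>2)"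
    by (subst sum.swap) (simp add: sum_distrib_right)
  also have "\<dots> = ?\<theta> * dispersion z"
    by (simp add: sum_subtractf cols dispersion_def sum_distrib_left)
  finally show ?thesis by (simp add: power2_eq_square mult.assoc)
qed

lemma dispersion_doubly_stochastic_le:
  fixes z :: "'v::finite \<Rightarrow> 'a::real_inner"
  assumes W: "doubly_stochastic W"
  shows "dispersion (\<lambda>i. \<Sum>j\<in>UNIV. W i j *\<^sub>R z j) \<le> dispersion z"
  using dispersion_doubly_stochastic_contract[OF W, of 0 z] W
  by (auto simp: doubly_stochastic_def)

lemma sum_norm_sq_doubly_stochastic_le:
  fixes z :: "'v::finite \<Rightarrow> 'a::real_inner"
  assumes W: "doubly_stochastic W"
  shows "(\<Sum>i\<in>UNIV. (norm (\<Sum>j\<in>UNIV. W i j *\<^sub>R z j))\<^sup>2) \<le> (\<Sum>i\<in>UNIV. (norm (z i))\<^sup>2)"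
proof -
  let ?y = "\<lambda>i. \<Sum>j\<in>UNIV. W i j *\<^sub>R z j"
  show ?thesis
    using sum_norm_sq_shift[of ?y 0] sum_norm_sq_shift[of z 0]
      dispersion_doubly_stochastic_le[OF W, of z]
    by (simp add: average_doubly_stochastic[OF W])
qed

text \<open>The product of the \<open>m\<close> matrices from time \<open>k\<close> on, \<open>A (k+m-1) \<cdots> A k\<close>.\<close>

primrec transition ::
    "(nat \<Rightarrow> 'v::finite \<Rightarrow> 'v \<Rightarrow> real) \<Rightarrow> nat \<Rightarrow> nat \<Rightarrow> 'v \<Rightarrow> 'v \<Rightarrow> real" where
  "transition A k 0 = (\<lambda>i j. if i = j then 1 else 0)"
| "transition A k (Suc m) = (\<lambda>i j. \<Sum>l\<in>UNIV. A (k + m) i l * transition A k m l j)"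

lemma doubly_stochastic_transition:
  assumes "\<And>k. doubly_stochastic (A k)"
  shows "doubly_stochastic (transition A k m)"
proof (induction m)
  case 0
  show ?case by (simp add: doubly_stochastic_def)
next
  case (Suc m)
  let ?P = "transition A k m"
  have A: "A (k + m) i l \<ge> 0" "(\<Sum>l\<in>UNIV. A (k + m) i l) = 1"
    "(\<Sum>i\<in>UNIV. A (k + m) i l) = 1" for i l
    using assms by (auto simp: doubly_stochastic_def)
  have P: "?P i l \<ge> 0" "(\<Sum>l\<in>UNIV. ?P i l) = 1" "(\<Sum>i\<in>UNIV. ?P i l) = 1" for i l
    using Suc by (auto simp: doubly_stochastic_def)
  have "(\<Sum>j\<in>UNIV. \<Sum>l\<in>UNIV. A (k + m) i l * ?P l j) = 1" for i
    by (subst sum.swap) (simp add: A P flip: sum_distrib_left)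
  moreover have "(\<Sum>i\<in>UNIV. \<Sum>l\<in>UNIV. A (k + m) i l * ?P l j) = 1" for j
    by (subst sum.swap) (simp add: A P flip: sum_distrib_right)
  ultimately show ?case by (auto simp: doubly_stochastic_def A P intro!: sum_nonneg)
qed

lemma transition_step_ge:
  assumes ds: "\<And>k. doubly_stochastic (A k)" and "\<eta> > 0"
    and "transition A k m u j \<ge> \<eta> ^ m" "A (k + m) i u \<ge> \<eta>"
  shows "transition A k (Suc m) i j \<ge> \<eta> ^ Suc m"
proof -
  have nonneg: "A (k + m) i l \<ge> 0" "transition A k m l j \<ge> 0" for l
    using ds doubly_stochastic_transition[of A k m, OF ds] by (auto simp: doubly_stochastic_def)
  have "\<eta> ^ Suc m \<le> A (k + m) i u * transition A k m u j"
    using assms by (auto intro!: mult_mono nonneg)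
  also have "\<dots> \<le> transition A k (Suc m) i j"
    unfolding transition.simps by (rule member_le_sum) (auto simp: nonneg)
  finally show ?thesis .
qed

lemma transition_entry_ge_mono:
  assumes ds: "\<And>k. doubly_stochastic (A k)" and "\<eta> > 0" and diag: "\<And>k i. A k i i \<ge> \<eta>"
    and "transition A k m i j \<ge> \<eta> ^ m" "m \<le> n"
  shows "transition A k n i j \<ge> \<eta> ^ n"
  using \<open>m \<le> n\<close> assms(4)
  by (induction rule: dec_induct) (auto intro!: transition_step_ge assms simp del: transition.simps power_Suc)

text \<open>Information spreads along one recurrent edge in any \<open>T\<close> consecutive steps, and it is
  never lost, because of the self-loops.\<close>

lemma transition_entry_ge_along_path:
  assumes ds: "\<And>k. doubly_stochastic (A k)" and \<eta>: "\<eta> > 0" and diag: "\<And>k i. A k i i \<ge> \<eta>"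
    and pos: "\<And>k i j. A k i j > 0 \<Longrightarrow> A k i j \<ge> \<eta>"
    and window: "\<And>e k. e \<in> E \<Longrightarrow> e \<in> (\<Union>s\<in>{k..<k + T}. edges A s)"
    and path: "(j, i) \<in> E ^^ n"
  shows "transition A k (n * T) i j \<ge> \<eta> ^ (n * T)"
  using path
proof (induction n arbitrary: i)
  case 0
  thus ?case by simp
next
  case (Suc n)
  then obtain u where u: "(j, u) \<in> E ^^ n" "(u, i) \<in> E" by auto
  from window[OF u(2), of "k + n * T"] obtain s where
    s: "k + n * T \<le> s" "s < k + n * T + T" "A s i u > 0" by (auto simp: edges_def)
  define m where "m = s - k"
  have m: "s = k + m" "n * T \<le> m" "Suc m \<le> Suc n * T" using s by (auto simp: m_def)
  have "transition A k m u j \<ge> \<eta> ^ m"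
    by (rule transition_entry_ge_mono[OF ds \<eta> diag Suc.IH[OF u(1)] m(2)])
  hence "transition A k (Suc m) i j \<ge> \<eta> ^ Suc m"
    using pos[OF s(3)] by (intro transition_step_ge[where u=u] ds \<eta>) (auto simp: m)
  thus ?case by (rule transition_entry_ge_mono[OF ds \<eta> diag]) (use m in simp)
qed

text \<open>One number of steps works for all pairs of agents and all starting times, because there
  are only finitely many pairs.\<close>

lemma transition_uniformly_positive:
  fixes A :: "nat \<Rightarrow> 'v::finite \<Rightarrow> 'v \<Rightarrow> real"
  assumes ds: "\<And>k. doubly_stochastic (A k)" and \<eta>: "\<eta> > 0" and diag: "\<And>k i. A k i i \<ge> \<eta>"
    and pos: "\<And>k i j. A k i j > 0 \<Longrightarrow> A k i j \<ge> \<eta>"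
    and window: "\<And>e k. e \<in> E \<Longrightarrow> e \<in> (\<Union>s\<in>{k..<k + T}. edges A s)"
    and conn: "strongly_connected E"
  obtains m where "\<And>k i j. transition A k m i j \<ge> \<eta> ^ m"
proof -
  have "\<exists>n. e \<in> E ^^ n" for e
    using conn by (cases e) (auto simp: strongly_connected_def rtrancl_is_UN_relpow)
  then obtain len where len: "\<And>e. e \<in> E ^^ len e" by metis
  define n where "n = Max (range len)"
  have "transition A k (n * T) i j \<ge> \<eta> ^ (n * T)" for k i j
  proof -
    have "len (j, i) \<le> n" by (simp add: n_def)
    thus ?thesis
      by (intro transition_entry_ge_mono[OF ds \<eta> diag
          transition_entry_ge_along_path[OF ds \<eta> diag pos window len[of "(j, i)"]]] mult_right_mono) auto
  qed
  thus thesis by (rule that)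
qed

text \<open>The crude factor \<open>2 ^ m\<close> for the accumulated perturbation suffices, because \<open>m\<close> stays
  fixed in the application.\<close>

lemma perturbed_averaging_decomposition:
  fixes z e :: "nat \<Rightarrow> 'v::finite \<Rightarrow> 'a::real_inner"
  assumes ds: "\<And>k. doubly_stochastic (A k)"
    and step: "\<And>k i. z (Suc k) i = (\<Sum>j\<in>UNIV. A k i j *\<^sub>R z k j) + e k i"
  shows "\<exists>r. (\<forall>i. z (k + m) i = (\<Sum>j\<in>UNIV. transition A k m i j *\<^sub>R z k j) + r i) \<and>
    (\<Sum>i\<in>UNIV. (norm (r i))\<^sup>2) \<le> 2 ^ m * (\<Sum>s<m. \<Sum>i\<in>UNIV. (norm (e (k + s) i))\<^sup>2)"
proof (induction m)
  case 0
  have "(if i = j then 1 else 0) *\<^sub>R z k j = (if i = j then z k j else 0)" for i j by auto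
  thus ?case by (intro exI[of _ "\<lambda>_. 0"]) simp
next
  case (Suc m)
  then obtain r where r: "\<And>i. z (k + m) i = (\<Sum>j\<in>UNIV. transition A k m i j *\<^sub>R z k j) + r i"
    "(\<Sum>i\<in>UNIV. (norm (r i))\<^sup>2) \<le> 2 ^ m * (\<Sum>s<m. \<Sum>i\<in>UNIV. (norm (e (k + s) i))\<^sup>2)"
    by blast
  let ?E = "\<lambda>s. \<Sum>i\<in>UNIV. (norm (e (k + s) i))\<^sup>2"
  let ?Ar = "\<lambda>i. \<Sum>l\<in>UNIV. A (k + m) i l *\<^sub>R r l"
  define r' where "r' = (\<lambda>i. ?Ar i + e (k + m) i)"
  have "z (k + Suc m) i = (\<Sum>j\<in>UNIV. transition A k (Suc m) i j *\<^sub>R z k j) + r' i" for i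
  proof -
    have "(\<Sum>l\<in>UNIV. A (k + m) i l *\<^sub>R (\<Sum>j\<in>UNIV. transition A k m l j *\<^sub>R z k j))
      = (\<Sum>j\<in>UNIV. transition A k (Suc m) i j *\<^sub>R z k j)"
      by (simp add: scaleR_sum_right scaleR_sum_left) (rule sum.swap)
    thus ?thesis by (simp add: step r(1) r'_def scaleR_add_right sum.distrib)
  qed
  moreover have "(\<Sum>i\<in>UNIV. (norm (r' i))\<^sup>2) \<le> 2 ^ Suc m * (\<Sum>s<Suc m. ?E s)"
  proof -
    have "(\<Sum>i\<in>UNIV. (norm (r' i))\<^sup>2)
        \<le> (\<Sum>i\<in>UNIV. 2 * (norm (?Ar i))\<^sup>2 + 2 * (norm (e (k + m) i))\<^sup>2)"
      unfolding r'_def by (intro sum_mono norm_add_sq_le2)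
    also have "\<dots> = 2 * (\<Sum>i\<in>UNIV. (norm (?Ar i))\<^sup>2) + 2 * ?E m"
      by (simp add: sum.distrib sum_distrib_left)
    also have "\<dots> \<le> 2 * (2 ^ m * (\<Sum>s<m. ?E s)) + 2 ^ Suc m * ?E m"
      using order_trans[OF sum_norm_sq_doubly_stochastic_le[OF ds] r(2)]
      by (intro add_mono mult_right_mono) (auto intro: sum_nonneg)
    finally show ?thesis by (simp add: algebra_simps)
  qed
  ultimately show ?case by blast
qed

text \<open>Over a window of fixed length \<open>m\<close> the dispersion contracts up to the squared
  perturbations. The factor \<open>\<theta> < 1\<close> by which the product of the weights at least
  contracts is weakened to \<open>q = (2 - \<theta>) \<theta> < 1\<close> in order to separate the perturbations from the
  initial deviations.\<close>

lemma dispersion_perturbed_averaging: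
  fixes A :: "nat \<Rightarrow> 'v::finite \<Rightarrow> 'v \<Rightarrow> real"
  assumes ds: "\<And>k. doubly_stochastic (A k)" and \<eta>: "\<eta> > 0" and diag: "\<And>k i. A k i i \<ge> \<eta>"
    and pos: "\<And>k i j. A k i j > 0 \<Longrightarrow> A k i j \<ge> \<eta>"
    and window: "\<And>e k. e \<in> E \<Longrightarrow> e \<in> (\<Union>s\<in>{k..<k + T}. edges A s)"
    and conn: "strongly_connected E"
  obtains m q C where "0 \<le> q" "q < 1" "0 \<le> C"
    "\<And>(z :: nat \<Rightarrow> 'v \<Rightarrow> 'a::real_inner) e k.
      (\<And>k i. z (Suc k) i = (\<Sum>j\<in>UNIV. A k i j *\<^sub>R z k j) + e k i) \<Longrightarrow>
      dispersion (z (k + m))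
        \<le> q * dispersion (z k) + C * (\<Sum>s<m. \<Sum>i\<in>UNIV. (norm (e (k + s) i))\<^sup>2)"
proof -
  obtain m where m: "\<And>k i j. transition A k m i j \<ge> \<eta> ^ m"
    using transition_uniformly_positive[OF ds \<eta> diag pos window conn] by blast
  define \<theta> where "\<theta> = 1 - real CARD('v) * \<eta> ^ m"
  have "(\<Sum>j\<in>(UNIV::'v set). \<eta> ^ m) \<le> (\<Sum>j\<in>UNIV. transition A 0 m undefined j)"
    by (intro sum_mono m)
  also have "\<dots> = 1"
    using doubly_stochastic_transition[of A 0 m, OF ds] by (simp add: doubly_stochastic_def)
  finally have \<theta>0: "\<theta> \<ge> 0" by (simp add: \<theta>_def)
  have \<theta>1: "\<theta> < 1" using \<eta> by (simp add: \<theta>_def)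
  define q where "q = (2 - \<theta>) * \<theta>"
  define C where "C = (1 + 1 / (1 - \<theta>)) * 2 ^ m"
  have "q = 1 - (1 - \<theta>)\<^sup>2" by (simp add: q_def power2_eq_square algebra_simps)
  hence q1: "q < 1" using \<theta>1 by simp
  have "dispersion (z (k + m))
        \<le> q * dispersion (z k) + C * (\<Sum>s<m. \<Sum>i\<in>UNIV. (norm (e (k + s) i))\<^sup>2)"
    if step: "\<And>k i. z (Suc k) i = (\<Sum>j\<in>UNIV. A k i j *\<^sub>R z k j) + e k i"
    for z e :: "nat \<Rightarrow> 'v \<Rightarrow> 'a" and k
  proof -
    obtain r where r: "\<And>i. z (k + m) i = (\<Sum>j\<in>UNIV. transition A k m i j *\<^sub>R z k j) + r i"
      "(\<Sum>i\<in>UNIV. (norm (r i))\<^sup>2) \<le> 2 ^ m * (\<Sum>s<m. \<Sum>i\<in>UNIV. (norm (e (k + s) i))\<^sup>2)"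
      using perturbed_averaging_decomposition[where z=z and e=e and k=k and m=m, OF ds step] by blast
    let ?Pz = "\<lambda>i. \<Sum>j\<in>UNIV. transition A k m i j *\<^sub>R z k j"
    have "dispersion ?Pz \<le> \<theta>\<^sup>2 * dispersion (z k)"
      unfolding \<theta>_def
      by (rule dispersion_doubly_stochastic_contract[OF doubly_stochastic_transition[OF ds] m])
    also have "\<dots> \<le> \<theta> * dispersion (z k)"
      using \<theta>0 \<theta>1 by (intro mult_right_mono dispersion_nonneg) (simp add: power2_eq_square mult_left_le)
    finally have Pz: "dispersion ?Pz \<le> \<theta> * dispersion (z k)" .
    have "dispersion (z (k + m)) = dispersion (\<lambda>i. ?Pz i + r i)" using r(1) by presburger
    also have "\<dots> \<le> (1 + (1 - \<theta>)) * dispersion ?Pz + (1 + 1 / (1 - \<theta>)) * dispersion r"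
      by (rule dispersion_add_le) (use \<theta>1 in simp)
    also have "\<dots> \<le> (1 + (1 - \<theta>)) * (\<theta> * dispersion (z k)) + (1 + 1 / (1 - \<theta>)) *
        (2 ^ m * (\<Sum>s<m. \<Sum>i\<in>UNIV. (norm (e (k + s) i))\<^sup>2))"
      using \<theta>1 r(2) dispersion_le_sum_norm_sq[of r]
      by (intro add_mono mult_left_mono Pz) auto
    finally show ?thesis by (simp add: q_def C_def algebra_simps)
  qed
  moreover have "0 \<le> q" "0 \<le> C" using \<theta>0 \<theta>1 by (auto simp: q_def C_def)
  ultimately show thesis using q1 that by blast
qed

section \<open>A descent argument for real sequences\<close>

lemma sum_lessThan_le_shift:
  fixes g :: "nat \<Rightarrow> real"
  assumes "\<And>k. g k \<ge> 0"
  shows "(\<Sum>k<T. g k) \<le> (\<Sum>k<m. g k) + (\<Sum>k<T. g (k + m))"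
proof (induction m)
  case (Suc m)
  have "(\<Sum>k<T. g (k + m)) \<le> (\<Sum>k<Suc T. g (k + m))" using assms by simp
  also have "\<dots> = g m + (\<Sum>k<T. g (k + Suc m))"
    by (subst sum.lessThan_Suc_shift) simp
  finally show ?case using Suc by simp
qed simp

lemma sum_lessThan_shift_le:
  fixes g :: "nat \<Rightarrow> real"
  assumes "\<And>k. 0 \<le> g k" "\<And>k. g k \<le> c"
  shows "(\<Sum>k<T. g (k + s)) \<le> (\<Sum>k<T. g k) + real s * c"
proof (induction s)
  case (Suc s)
  have "(\<Sum>k<T. g (k + Suc s)) \<le> g s + (\<Sum>k<T. g (k + Suc s))" using assms by simp
  also have "\<dots> = (\<Sum>k<Suc T. g (k + s))" by (subst sum.lessThan_Suc_shift) simp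
  also have "\<dots> \<le> (\<Sum>k<T. g (k + s)) + c" using assms by simp
  finally show ?case using Suc by (simp add: algebra_simps)
qed simp

text \<open>\<open>\<Phi>\<close> is a Lyapunov function that descends by a multiple of \<open>\<alpha> k * D k\<close>, up to
  multiples of an error \<open>u k\<close> and of \<open>(\<alpha> k)\<^sup>2\<close>. The partial sums of both errors are at most
  affine in those of the squared stepsizes, which are of lower order than the divergent partial sums
  of the stepsizes because \<open>\<alpha>\<close> tends to \<open>0\<close>. Hence \<open>D\<close> cannot stay above \<open>\<epsilon>\<close>.\<close>

lemma descent_exists_small:
  fixes \<Phi> D u \<alpha> :: "nat \<Rightarrow> real"
  assumes descent: "\<And>k. \<Phi> (Suc k) \<le> \<Phi> k - a * \<alpha> k * D k + C1 * u k + C2 * (\<alpha> k)\<^sup>2"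
    and lower: "\<And>k. \<Phi> k \<ge> l"
    and contract: "\<And>k. u (k + m) \<le> q * u k + C3 * (\<Sum>s<m. (\<alpha> (k + s))\<^sup>2)"
    and u: "\<And>k. u k \<ge> 0" and q: "q < 1" and C: "a > 0" "C1 \<ge> 0" "C2 \<ge> 0" "C3 \<ge> 0"
    and \<alpha>: "\<And>k. \<alpha> k > 0" "\<alpha> \<longlonglongrightarrow> 0" "filterlim (\<lambda>n. \<Sum>k<n. \<alpha> k) at_top sequentially"
    and \<epsilon>: "\<epsilon> > 0"
  shows "\<exists>k. D k < \<epsilon>"
proof (rule ccontr)
  assume "\<not> ?thesis"
  hence D: "D k \<ge> \<epsilon>" for k by (auto simp: not_less)
  have "Bseq \<alpha>" using \<alpha>(2) by (intro convergent_imp_Bseq) (auto simp: convergent_def)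
  then obtain am where am: "am > 0" "\<And>k. norm (\<alpha> k) \<le> am" by (auto elim: BseqE)
  have \<alpha>m: "\<alpha> k \<le> am" for k using am(2)[of k] \<alpha>(1)[of k] by simp
  have \<alpha>m2: "(\<alpha> k)\<^sup>2 \<le> am\<^sup>2" for k
    using \<alpha>m[of k] \<alpha>(1)[of k] by (simp add: power_mono less_imp_le)
  let ?Q = "\<lambda>T. \<Sum>k<T. (\<alpha> k)\<^sup>2"
  let ?U = "\<lambda>T. \<Sum>k<T. u k"
  define K where "K = (?U m + C3 * real m * (real m * am\<^sup>2)) / (1 - q)"
  define K' where "K' = C3 * real m / (1 - q)"
  have K': "K' \<ge> 0" using C q by (simp add: K'_def)
  \<comment> \<open>summing the contraction controls the total consensus error by the sum of squared stepsizes\<close>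
  have U: "?U T \<le> K + K' * ?Q T" for T
  proof -
    have "?U T \<le> ?U m + (\<Sum>k<T. u (k + m))" by (rule sum_lessThan_le_shift) (rule u)
    also have "\<dots> \<le> ?U m + (\<Sum>k<T. q * u k + C3 * (\<Sum>s<m. (\<alpha> (k + s))\<^sup>2))"
      by (intro add_left_mono sum_mono contract)
    also have "(\<Sum>k<T. q * u k + C3 * (\<Sum>s<m. (\<alpha> (k + s))\<^sup>2))
        = q * ?U T + C3 * (\<Sum>k<T. \<Sum>s<m. (\<alpha> (k + s))\<^sup>2)"
      by (simp add: sum.distrib sum_distrib_left)
    also have "(\<Sum>k<T. \<Sum>s<m. (\<alpha> (k + s))\<^sup>2) = (\<Sum>s<m. \<Sum>k<T. (\<alpha> (k + s))\<^sup>2)"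
      by (rule sum.swap)
    also have "C3 * \<dots> \<le> C3 * (\<Sum>s<m. ?Q T + real m * am\<^sup>2)"
    proof (intro mult_left_mono sum_mono C)
      fix s assume "s \<in> {..<m}"
      have "(\<Sum>k<T. (\<alpha> (k + s))\<^sup>2) \<le> ?Q T + real s * am\<^sup>2"
        by (rule sum_lessThan_shift_le[where g="\<lambda>k. (\<alpha> k)\<^sup>2"]) (use \<alpha>m2 in auto)
      also have "\<dots> \<le> ?Q T + real m * am\<^sup>2"
        using \<open>s \<in> {..<m}\<close> by (intro add_left_mono mult_right_mono) auto
      finally show "(\<Sum>k<T. (\<alpha> (k + s))\<^sup>2) \<le> ?Q T + real m * am\<^sup>2" .
    qed
    finally have "(1 - q) * ?U T \<le> ?U m + C3 * real m * (real m * am\<^sup>2) + C3 * real m * ?Q T"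
      by (simp add: algebra_simps)
    hence "?U T \<le> (?U m + C3 * real m * (real m * am\<^sup>2) + C3 * real m * ?Q T) / (1 - q)"
      using q by (simp add: pos_le_divide_eq mult.commute)
    thus ?thesis by (simp add: K_def K'_def add_divide_distrib)
  qed
  have telescope: "\<Phi> T \<le> \<Phi> 0 - a * \<epsilon> * (\<Sum>k<T. \<alpha> k) + C1 * ?U T + C2 * ?Q T" for T
  proof (induction T)
    case (Suc T)
    have "a * \<alpha> T * \<epsilon> \<le> a * \<alpha> T * D T"
      using C \<alpha>(1)[of T] D[of T] by (intro mult_left_mono) auto
    thus ?case using Suc descent[of T] by (simp add: algebra_simps)
  qed simp
  define C' where "C' = C1 * K' + C2"
  have C': "C' \<ge> 0" using K' C by (simp add: C'_def)
  \<comment> \<open>stepsizes below \<open>\<delta>\<close> leave half of the descent after the quadratic errors\<close>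
  define \<delta> where "\<delta> = a * \<epsilon> / (2 * (C' + 1))"
  have \<delta>: "\<delta> > 0" using C C' \<epsilon> by (simp add: \<delta>_def)
  have C'\<delta>: "C' * \<delta> \<le> a * \<epsilon> / 2" using C C' \<epsilon> by (simp add: \<delta>_def field_simps)
  obtain k0 where k0: "\<And>k. k \<ge> k0 \<Longrightarrow> \<alpha> k \<le> \<delta>"
    using order_tendstoD(2)[OF \<alpha>(2) \<delta>] by (auto simp: eventually_sequentially intro: less_imp_le)
  have Q: "?Q T \<le> ?Q k0 + \<delta> * (\<Sum>k<T. \<alpha> k)" for T
  proof -
    have "?Q T \<le> (\<Sum>k<T. (if k < k0 then (\<alpha> k)\<^sup>2 else 0) + \<delta> * \<alpha> k)"
    proof (rule sum_mono)
      fix k show "(\<alpha> k)\<^sup>2 \<le> (if k < k0 then (\<alpha> k)\<^sup>2 else 0) + \<delta> * \<alpha> k"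
        using k0[of k] \<alpha>(1)[of k] \<delta> by (auto simp: power2_eq_square)
    qed
    also have "\<dots> = (\<Sum>k<T. (if k < k0 then (\<alpha> k)\<^sup>2 else 0)) + \<delta> * (\<Sum>k<T. \<alpha> k)"
      by (simp add: sum.distrib sum_distrib_left)
    also have "(\<Sum>k<T. (if k < k0 then (\<alpha> k)\<^sup>2 else 0)) = (\<Sum>k\<in>{..<T} \<inter> {..<k0}. (\<alpha> k)\<^sup>2)"
      by (simp add: sum.inter_restrict)
    also have "\<dots> \<le> ?Q k0" by (rule sum_mono2) auto
    finally show ?thesis by simp
  qed
  have "(\<Sum>k<T. \<alpha> k) \<le> (\<Phi> 0 - l + C1 * K + C' * ?Q k0) / (a * \<epsilon> / 2)" for T
  proof -
    let ?S = "\<Sum>k<T. \<alpha> k"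
    have S: "?S \<ge> 0" using \<alpha>(1) by (intro sum_nonneg) (auto intro: less_imp_le)
    have "l \<le> \<Phi> 0 - a * \<epsilon> * ?S + C1 * ?U T + C2 * ?Q T"
      using telescope[of T] lower[of T] by simp
    also have "\<dots> \<le> \<Phi> 0 - a * \<epsilon> * ?S + C1 * (K + K' * ?Q T) + C2 * ?Q T"
      using U[of T] C by (simp add: mult_left_mono)
    also have "\<dots> = \<Phi> 0 - a * \<epsilon> * ?S + C1 * K + C' * ?Q T"
      by (simp add: C'_def algebra_simps)
    also have "\<dots> \<le> \<Phi> 0 - a * \<epsilon> * ?S + C1 * K + C' * (?Q k0 + \<delta> * ?S)"
      using Q[of T] C' by (simp add: mult_left_mono)
    also have "\<dots> \<le> \<Phi> 0 - a * \<epsilon> * ?S + C1 * K + C' * ?Q k0 + a * \<epsilon> / 2 * ?S"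
      using mult_right_mono[OF C'\<delta> S] by (simp add: algebra_simps)
    finally have "?S * (a * \<epsilon> / 2) \<le> \<Phi> 0 - l + C1 * K + C' * ?Q k0"
      by (simp add: algebra_simps)
    thus ?thesis using C \<epsilon> by (subst pos_le_divide_eq) auto
  qed
  moreover obtain T where "(\<Sum>k<T. \<alpha> k) > (\<Phi> 0 - l + C1 * K + C' * ?Q k0) / (a * \<epsilon> / 2)"
    using \<alpha>(3) by (auto simp: filterlim_at_top_dense eventually_sequentially)
  ultimately show False by (meson not_le)
qed

section \<open>Weakly convex functions\<close>

lemma weakly_convex_iff:
  "weakly_convex \<rho> f \<longleftrightarrow> convex_on UNIV (\<lambda>x. f x + \<rho> / 2 * (norm x)\<^sup>2)"
proof
  assume "weakly_convex \<rho> f"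
  then obtain h where h: "convex_on UNIV h" "f = (\<lambda>x. h x - \<rho> / 2 * (norm x)\<^sup>2)"
    by (auto simp: weakly_convex_def)
  have "(\<lambda>x. f x + \<rho> / 2 * (norm x)\<^sup>2) = h" by (simp add: h(2))
  thus "convex_on UNIV (\<lambda>x. f x + \<rho> / 2 * (norm x)\<^sup>2)" using h(1) by simp
next
  assume "convex_on UNIV (\<lambda>x. f x + \<rho> / 2 * (norm x)\<^sup>2)"
  thus "weakly_convex \<rho> f"
    unfolding weakly_convex_def
    by (intro exI[of _ "\<lambda>x. f x + \<rho> / 2 * (norm x)\<^sup>2"]) auto
qed

lemma convex_on_sum_functions:
  fixes h :: "'i \<Rightarrow> 'a::real_vector \<Rightarrow> real"
  assumes "finite I" "convex S" "\<And>i. i \<in> I \<Longrightarrow> convex_on S (h i)"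
  shows "convex_on S (\<lambda>x. \<Sum>i\<in>I. h i x)"
  using assms
proof (induction I)
  case empty
  thus ?case by (simp add: convex_on_def)
next
  case (insert i I)
  thus ?case using convex_on_add[of S "h i" "\<lambda>x. \<Sum>i\<in>I. h i x"] by simp
qed

lemma weakly_convex_average:
  assumes "\<And>i::'v::finite. weakly_convex \<rho> (fi i)"
  shows "weakly_convex \<rho> (\<lambda>y. average (\<lambda>i. fi i y))"
proof -
  have "convex_on UNIV (\<lambda>x. \<Sum>i\<in>(UNIV::'v set). (1 / real CARD('v)) * (fi i x + \<rho> / 2 * (norm x)\<^sup>2))"
    using assms by (intro convex_on_sum_functions convex_on_cmul) (auto simp: weakly_convex_iff)
  moreover have "(\<Sum>i\<in>(UNIV::'v set). (1 / real CARD('v)) * (fi i x + \<rho> / 2 * (norm x)\<^sup>2))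
      = average (\<lambda>i. fi i x) + \<rho> / 2 * (norm x)\<^sup>2" for x
    unfolding sum_distrib_left[symmetric] by (simp add: average_def sum.distrib algebra_simps)
  ultimately show ?thesis by (simp add: weakly_convex_iff)
qed

text \<open>The point \<open>(x, h x)\<close> is separated from the strict epigraph; a separating hyperplane
  cannot be vertical, because \<open>h\<close> is finite everywhere.\<close>

lemma convex_subdifferential_nonempty:
  fixes h :: "'a::euclidean_space \<Rightarrow> real"
  assumes "convex_on UNIV h"
  shows "convex_subdifferential h x \<noteq> {}"
proof -
  let ?S = "{p :: 'a \<times> real. h (fst p) < snd p}"
  have "convex ?S"
  proof (rule convexI)
    fix p q :: "'a \<times> real" and u v :: real
    assume pq: "p \<in> ?S" "q \<in> ?S" and uv: "0 \<le> u" "0 \<le> v" "u + v = 1"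
    have "h (u *\<^sub>R fst p + v *\<^sub>R fst q) \<le> u * h (fst p) + v * h (fst q)"
      using assms uv by (auto simp: convex_on_def)
    also have "\<dots> < u * snd p + v * snd q"
    proof (cases "u = 0")
      case True
      thus ?thesis using pq uv by simp
    next
      case False
      thus ?thesis using pq uv
        by (intro add_less_le_mono mult_strict_left_mono mult_left_mono) auto
    qed
    finally show "u *\<^sub>R p + v *\<^sub>R q \<in> ?S" by simp
  qed
  moreover have "(x, h x + 1) \<in> ?S" by simp
  hence "?S \<noteq> {}" by blast
  ultimately obtain n b where n: "n \<noteq> 0" "\<forall>p\<in>{(x, h x)}. n \<bullet> p \<le> b" "\<forall>p\<in>?S. n \<bullet> p \<ge> b"
    using separating_hyperplane_sets[of "{(x, h x)}" ?S] by auto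
  obtain a c where ac: "n = (a, c)" by (cases n)
  have sep: "a \<bullet> x + c * h x \<le> a \<bullet> y + c * r" if "h y < r" for y r
    using n(2) bspec[OF n(3), of "(y, r)"] that by (auto simp: ac)
  have "c \<ge> 0" using sep[of x "h x + 1"] by (simp add: algebra_simps)
  moreover have "c \<noteq> 0"
  proof
    assume [simp]: "c = 0"
    have "a \<bullet> x \<le> a \<bullet> (x - a)" using sep[of "x - a" "h (x - a) + 1"] by simp
    hence "a \<bullet> a \<le> 0" by (simp add: inner_diff_right)
    hence "a = 0" by (meson inner_gt_zero_iff not_le)
    thus False using n(1) ac by (simp add: zero_prod_def)
  qed
  ultimately have c: "c > 0" by simp
  have "h y \<ge> h x + (- (1 / c) *\<^sub>R a) \<bullet> (y - x)" for y
  proof (rule field_le_epsilon)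
    fix e :: real assume "e > 0"
    have "a \<bullet> x + c * h x \<le> a \<bullet> y + c * (h y + e)" by (rule sep) (use \<open>e > 0\<close> in simp)
    thus "h x + (- (1 / c) *\<^sub>R a) \<bullet> (y - x) \<le> h y + e"
      using c by (simp add: inner_diff_right field_simps)
  qed
  hence "- (1 / c) *\<^sub>R a \<in> convex_subdifferential h x"
    unfolding convex_subdifferential_def by blast
  thus ?thesis by blast
qed

lemma subdifferential_nonempty:
  assumes "weakly_convex \<rho> f"
  shows "subdifferential \<rho> f x \<noteq> {}"
  using assms convex_subdifferential_nonempty
  by (auto simp: subdifferential_def weakly_convex_iff)

lemma norm_diff_sq:
  fixes x y :: "'a::real_inner"
  shows "(norm (x - y))\<^sup>2 = (norm x)\<^sup>2 - 2 * (x \<bullet> y) + (norm y)\<^sup>2"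
  by (simp add: power2_norm_eq_inner inner_diff_left inner_diff_right inner_commute)

lemma subdifferential_ineq:
  assumes "g \<in> subdifferential \<rho> f x"
  shows "f y \<ge> f x + g \<bullet> (y - x) - \<rho> / 2 * (norm (y - x))\<^sup>2"
proof -
  obtain g0 where g0: "g = g0 - \<rho> *\<^sub>R x"
    "f y + \<rho> / 2 * (norm y)\<^sup>2 \<ge> f x + \<rho> / 2 * (norm x)\<^sup>2 + g0 \<bullet> (y - x)"
    using assms by (auto simp: subdifferential_def convex_subdifferential_def)
  show ?thesis
    using g0(2) unfolding g0(1) norm_diff_sq
    by (simp add: inner_diff_left inner_diff_right power2_norm_eq_inner inner_commute algebra_simps)
qed

section \<open>The proximal point and the Moreau envelope\<close>

text \<open>The function of \<open>y\<close> that is minimized in the Moreau envelope at \<open>x\<close>; the constraint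
  \<open>y \<in> X\<close> is kept separate, so that the values are real.\<close>

definition prox_objective :: "real \<Rightarrow> ('a::euclidean_space \<Rightarrow> real) \<Rightarrow> 'a \<Rightarrow> 'a \<Rightarrow> real" where
  "prox_objective t f x y = f y + 1 / (2 * t) * (norm (y - x))\<^sup>2"

text \<open>A minimizer of \<open>prox_objective t f x\<close> over \<open>X\<close>. If \<open>X\<close> is closed, convex and
  nonempty and \<open>f\<close> is bounded below and \<open>\<rho>\<close>-weakly convex with \<open>\<rho> < 1 / t\<close>, then there is
  exactly one, and the choice made by \<open>SOME\<close> is immaterial.\<close>

definition proximal_point :: "real \<Rightarrow> ('a::euclidean_space \<Rightarrow> real) \<Rightarrow> 'a set \<Rightarrow> 'a \<Rightarrow> 'a" where
  "proximal_point t f X x = (SOME p. p \<in> X \<and>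
     (\<forall>y\<in>X. prox_objective t f x p \<le> prox_objective t f x y))"

text \<open>The setting in which the Moreau envelope is differentiable.\<close>

locale weakly_convex_problem =
  fixes X :: "'a::euclidean_space set" and f :: "'a \<Rightarrow> real" and \<rho> t :: real
  assumes closed_X: "closed X" and convex_X: "convex X" and X_nonempty: "X \<noteq> {}"
    and bdd_below_f: "bdd_below (range f)" and weakly_convex_f: "weakly_convex \<rho> f"
    and t_pos: "t > 0" and \<rho>_less: "\<rho> < 1 / t"
begin

abbreviation "obj \<equiv> prox_objective t f"
abbreviation "prox \<equiv> proximal_point t f X"
abbreviation "env \<equiv> moreau_envelope t (constrained_objective f X)"

lemma continuous_f: "continuous_on UNIV f"
proof -
  have "continuous_on UNIV (\<lambda>x. f x + \<rho> / 2 * (norm x)\<^sup>2)"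
    using weakly_convex_f by (intro convex_on_continuous) (auto simp: weakly_convex_iff)
  hence "continuous_on UNIV (\<lambda>x. (f x + \<rho> / 2 * (norm x)\<^sup>2) - \<rho> / 2 * (norm x)\<^sup>2)"
    by (rule continuous_on_diff) (intro continuous_intros)
  thus ?thesis by simp
qed

text \<open>The proximal objective is continuous, and coercive because \<open>f\<close> is bounded below.\<close>

lemma prox_exists: "\<exists>p\<in>X. \<forall>y\<in>X. obj x p \<le> obj x y"
proof -
  obtain l where l: "\<And>y. l \<le> f y" using bdd_below_f by (auto simp: bdd_below_def)
  obtain x0 where x0: "x0 \<in> X" using X_nonempty by auto
  define c where "c = obj x x0"
  define r where "r = sqrt (2 * t * (c - l))"
  have near: "norm (y - x) \<le> r" if "obj x y \<le> c" for y
  proof -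
    have "1 / (2 * t) * (norm (y - x))\<^sup>2 \<le> c - l"
      using that l[of y] by (simp add: prox_objective_def)
    hence "(norm (y - x))\<^sup>2 \<le> 2 * t * (c - l)" using t_pos by (simp add: field_simps)
    thus ?thesis by (simp add: r_def real_le_rsqrt)
  qed
  have "compact (X \<inter> cball x r)" using closed_X by (simp add: closed_Int_compact)
  moreover have "x0 \<in> X \<inter> cball x r"
    using near[of x0] x0 by (simp add: c_def dist_norm norm_minus_commute)
  hence "X \<inter> cball x r \<noteq> {}" by blast
  moreover have "continuous_on (X \<inter> cball x r) (obj x)"
    unfolding prox_objective_def
    by (intro continuous_intros continuous_on_subset[OF continuous_f]) auto
  ultimately obtain p where p: "p \<in> X \<inter> cball x r" "\<And>y. y \<in> X \<inter> cball x r \<Longrightarrow> obj x p \<le> obj x y"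
    using continuous_attains_inf[of "X \<inter> cball x r" "obj x"] by blast
  have "obj x p \<le> obj x y" if "y \<in> X" for y
  proof (cases "obj x y \<le> c")
    case True
    thus ?thesis using p(2)[of y] near[of y] that by (simp add: dist_norm norm_minus_commute)
  next
    case False
    thus ?thesis using p(2)[OF \<open>x0 \<in> X \<inter> cball x r\<close>] by (simp add: c_def)
  qed
  thus ?thesis using p(1) by blast
qed

lemma prox_in: "prox x \<in> X" and prox_min: "y \<in> X \<Longrightarrow> obj x (prox x) \<le> obj x y"
  using someI_ex[of "\<lambda>p. p \<in> X \<and> (\<forall>y\<in>X. obj x p \<le> obj x y)"] prox_exists[of x]
  unfolding proximal_point_def by blast+

text \<open>The proximal objective is strongly convex with modulus \<open>1 / t - \<rho>\<close>: comparing its value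
  at the minimizer with that on the segment from there to \<open>y\<close> gives quadratic growth.\<close>

lemma prox_strong_min:
  assumes y: "y \<in> X"
  shows "obj x y \<ge> obj x (prox x) + (1 / t - \<rho>) / 2 * (norm (y - prox x))\<^sup>2"
proof -
  let ?p = "prox x" and ?h = "\<lambda>x. f x + \<rho> / 2 * (norm x)\<^sup>2"
  have "s * ((1 / t - \<rho>) / 2 * (norm (y - ?p))\<^sup>2) \<le> obj x y - obj x ?p" if s: "0 < s" "s < 1" for s
  proof -
    let ?y = "s *\<^sub>R ?p + (1 - s) *\<^sub>R y"
    have sq: "(norm (s *\<^sub>R u + (1 - s) *\<^sub>R v))\<^sup>2
        = s * (norm u)\<^sup>2 + (1 - s) * (norm v)\<^sup>2 - s * (1 - s) * (norm (v - u))\<^sup>2" for u v :: 'a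
      by (simp add: power2_norm_eq_inner inner_diff_left inner_diff_right inner_add_left
          inner_add_right inner_commute algebra_simps)
    have "?y - x = s *\<^sub>R (?p - x) + (1 - s) *\<^sub>R (y - x)" by (simp add: algebra_simps)
    hence sqx: "(norm (?y - x))\<^sup>2 = s * (norm (?p - x))\<^sup>2 + (1 - s) * (norm (y - x))\<^sup>2
        - s * (1 - s) * (norm (y - ?p))\<^sup>2"
      using sq[of "?p - x" "y - x"] by simp
    have "?h ?y \<le> s * ?h ?p + (1 - s) * ?h y"
      using weakly_convex_f s by (auto simp: weakly_convex_iff convex_on_def)
    hence fy: "f ?y \<le> s * f ?p + (1 - s) * f y + \<rho> / 2 * (s * (1 - s) * (norm (y - ?p))\<^sup>2)"
      unfolding sq[of ?p y] by (simp add: algebra_simps add_divide_distrib diff_divide_distrib)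
    have "obj x ?p \<le> obj x ?y"
      using convex_X prox_in y s by (intro prox_min) (auto simp: convex_def)
    also have "\<dots> \<le> s * obj x ?p + (1 - s) * obj x y
        - (1 - s) * (s * ((1 / t - \<rho>) / 2 * (norm (y - ?p))\<^sup>2))"
    proof -
      define \<tau> where "\<tau> = 1 / (2 * t)"
      have \<tau>: "1 / t = 2 * \<tau>" using t_pos by (simp add: \<tau>_def)
      show ?thesis using fy unfolding prox_objective_def sqx \<tau>_def[symmetric] \<tau>
        by (simp add: algebra_simps add_divide_distrib diff_divide_distrib)
    qed
    finally have "(1 - s) * (s * ((1 / t - \<rho>) / 2 * (norm (y - ?p))\<^sup>2))
        \<le> (1 - s) * (obj x y - obj x ?p)" by (simp add: algebra_simps)
    thus ?thesis using s by simp
  qed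
  hence "(1 / t - \<rho>) / 2 * (norm (y - ?p))\<^sup>2 \<le> obj x y - obj x ?p"
    by (rule field_le_mult_one_interval)
  thus ?thesis by linarith
qed

lemma obj_diff: "obj z y = obj x y + 1 / t * ((x - y) \<bullet> (z - x)) + 1 / (2 * t) * (norm (z - x))\<^sup>2"
proof -
  have "(norm (y - z))\<^sup>2 = (norm (y - x))\<^sup>2 + 2 * ((x - y) \<bullet> (z - x)) + (norm (z - x))\<^sup>2"
    by (simp add: power2_norm_eq_inner inner_diff_left inner_diff_right inner_commute)
  thus ?thesis unfolding prox_objective_def using t_pos by (simp add: field_simps)
qed

text \<open>Add the quadratic growth of the objectives at \<open>x\<close> and at \<open>z\<close>, each evaluated at the
  other minimizer.\<close>

lemma prox_lipschitz: "norm (prox z - prox x) \<le> 1 / (1 - \<rho> * t) * norm (z - x)"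
proof -
  let ?d = "prox z - prox x" and ?e = "z - x" and ?\<mu> = "1 / t - \<rho>"
  have \<mu>: "?\<mu> > 0" using \<rho>_less by simp
  have 1: "obj x (prox z) \<ge> obj x (prox x) + ?\<mu> / 2 * (norm ?d)\<^sup>2"
    by (rule prox_strong_min[OF prox_in])
  have 2: "obj z (prox x) \<ge> obj z (prox z) + ?\<mu> / 2 * (norm ?d)\<^sup>2"
    using prox_strong_min[OF prox_in, of z x] by (simp add: norm_minus_commute)
  have "?\<mu> * (norm ?d)\<^sup>2 = ?\<mu> / 2 * (norm ?d)\<^sup>2 + ?\<mu> / 2 * (norm ?d)\<^sup>2" by (simp add: algebra_simps)
  also have "\<dots> \<le> obj x (prox z) - obj x (prox x) + (obj z (prox x) - obj z (prox z))"
    using 1 2 by linarith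
  also have "\<dots> = 1 / t * (?d \<bullet> ?e)"
    unfolding obj_diff[of z _ x] by (simp add: inner_diff_left algebra_simps)
  also have "\<dots> \<le> 1 / t * (norm ?d * norm ?e)"
    using t_pos by (intro mult_left_mono norm_cauchy_schwarz) auto
  finally have "norm ?d * (?\<mu> * norm ?d) \<le> norm ?d * (norm ?e / t)"
    by (simp add: power2_eq_square algebra_simps)
  hence "?\<mu> * norm ?d \<le> norm ?e / t"
    using t_pos by (cases "norm ?d = 0") (simp, metis mult_left_le_imp_le norm_ge_zero less_eq_real_def)
  hence "t * (?\<mu> * norm ?d) \<le> t * (norm ?e / t)" using t_pos by (intro mult_left_mono) auto
  moreover have "t * (?\<mu> * norm ?d) = (1 - \<rho> * t) * norm ?d" using t_pos by (simp add: field_simps)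
  ultimately have "(1 - \<rho> * t) * norm ?d \<le> norm ?e" using t_pos by simp
  moreover have "1 - \<rho> * t > 0" using \<rho>_less t_pos by (simp add: field_simps)
  ultimately show ?thesis by (simp add: field_simps)
qed

lemma continuous_prox: "continuous_on UNIV prox"
proof (rule continuous_on_subset[OF lipschitz_on_continuous_on])
  have "1 / (1 - \<rho> * t) \<ge> 0" using \<rho>_less t_pos by (simp add: field_simps)
  thus "(1 / (1 - \<rho> * t))-lipschitz_on UNIV prox"
    using prox_lipschitz by (auto simp: lipschitz_on_def dist_norm)
qed simp

lemma env_eq: "env x = obj x (prox x)"
proof -
  let ?\<phi> = "\<lambda>y. constrained_objective f X y + ereal (1 / (2 * t) * (norm (y - x))\<^sup>2)"
  have in_X: "?\<phi> y = ereal (obj x y)" if "y \<in> X" for y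
    using that by (simp add: constrained_objective_def convex_indicator_def prox_objective_def)
  have "(INF y. ?\<phi> y) = ereal (obj x (prox x))"
  proof (rule antisym)
    show "(INF y. ?\<phi> y) \<le> ereal (obj x (prox x))"
      using INF_lower[of "prox x" UNIV ?\<phi>] in_X[OF prox_in[of x]] by simp
    show "ereal (obj x (prox x)) \<le> (INF y. ?\<phi> y)"
    proof (rule INF_greatest)
      fix y show "ereal (obj x (prox x)) \<le> ?\<phi> y"
      proof (cases "y \<in> X")
        case True
        thus ?thesis using prox_min[of y x] in_X[of y] by simp
      qed (simp add: constrained_objective_def convex_indicator_def)
    qed
  qed
  thus ?thesis by (simp add: moreau_envelope_def)
qed

lemma env_le: "y \<in> X \<Longrightarrow> env x \<le> f y + 1 / (2 * t) * (norm (y - x))\<^sup>2"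
  using prox_min[of y x] by (simp add: env_eq prox_objective_def)

text \<open>Comparing the minima at \<open>x\<close> and \<open>z\<close>, each with the other minimizer inserted, bounds
  the envelope above and below by the same affine function up to a quadratic error. This yields the
  gradient.\<close>

lemma env_taylor:
  "\<bar>env z - env x - (z - x) \<bullet> ((1 / t) *\<^sub>R (x - prox x))\<bar>
    \<le> (1 / (2 * t) + 1 / t * (1 / (1 - \<rho> * t))) * (norm (z - x))\<^sup>2"
proof -
  let ?e = "z - x" and ?l = "1 / (1 - \<rho> * t)"
  have l: "?l \<ge> 0" using \<rho>_less t_pos by (simp add: field_simps)
  have D: "?e \<bullet> ((1 / t) *\<^sub>R (x - prox x)) = 1 / t * ((x - prox x) \<bullet> ?e)"
    by (simp add: inner_commute)
  have "env z \<le> obj z (prox x)" unfolding env_eq by (rule prox_min[OF prox_in])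
  hence upper: "env z - env x - ?e \<bullet> ((1 / t) *\<^sub>R (x - prox x)) \<le> 1 / (2 * t) * (norm ?e)\<^sup>2"
    unfolding D env_eq[of x] obj_diff[of z _ x] by simp
  have "env x \<le> obj x (prox z)" unfolding env_eq by (rule prox_min[OF prox_in])
  moreover have "env z = obj x (prox z) + 1 / t * ((x - prox z) \<bullet> ?e) + 1 / (2 * t) * (norm ?e)\<^sup>2"
    unfolding env_eq by (rule obj_diff)
  moreover have "1 / (2 * t) * (norm ?e)\<^sup>2 \<ge> 0" using t_pos by simp
  ultimately have "env z - env x - ?e \<bullet> ((1 / t) *\<^sub>R (x - prox x))
      \<ge> 1 / t * ((x - prox z) \<bullet> ?e) - 1 / t * ((x - prox x) \<bullet> ?e)"
    unfolding D by linarith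
  also have "1 / t * ((x - prox z) \<bullet> ?e) - 1 / t * ((x - prox x) \<bullet> ?e)
      = - (1 / t * ((prox z - prox x) \<bullet> ?e))"
    by (simp add: inner_diff_left algebra_simps)
  finally have "env z - env x - ?e \<bullet> ((1 / t) *\<^sub>R (x - prox x))
      \<ge> - (1 / t * ((prox z - prox x) \<bullet> ?e))" .
  moreover have "1 / t * ((prox z - prox x) \<bullet> ?e) \<le> 1 / t * (?l * norm ?e * norm ?e)"
    using t_pos
    by (intro mult_left_mono order_trans[OF norm_cauchy_schwarz] mult_right_mono prox_lipschitz) auto
  ultimately have lower: "env z - env x - ?e \<bullet> ((1 / t) *\<^sub>R (x - prox x))
      \<ge> - (1 / t * ?l * (norm ?e)\<^sup>2)"
    by (simp add: power2_eq_square mult.assoc)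
  have "0 \<le> 1 / (2 * t) * (norm ?e)\<^sup>2" "0 \<le> 1 / t * ?l * (norm ?e)\<^sup>2"
    using t_pos l by auto
  thus ?thesis using upper lower unfolding abs_le_iff distrib_right by linarith
qed

lemma GDERIV_env: "GDERIV env x :> (1 / t) *\<^sub>R (x - prox x)"
proof -
  let ?D = "(1 / t) *\<^sub>R (x - prox x)"
  let ?C = "1 / (2 * t) + 1 / t * (1 / (1 - \<rho> * t))"
  have "((\<lambda>h. norm (env (x + h) - env x - h \<bullet> ?D) / norm h) \<longlongrightarrow> 0) (at 0)"
  proof (rule tendsto_sandwich[OF _ _ tendsto_const])
    show "((\<lambda>h. ?C * norm (h::'a)) \<longlongrightarrow> 0) (at 0)"
      by (auto intro!: tendsto_eq_intros)
    have "norm (env (x + h) - env x - h \<bullet> ?D) / norm h \<le> ?C * norm h" for h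
    proof (cases "h = 0")
      case False
      hence pos: "norm h > 0" by simp
      have "norm (env (x + h) - env x - h \<bullet> ?D) \<le> ?C * norm h * norm h"
        using env_taylor[of "x + h" x]
        by (simp only: add_diff_cancel_left' real_norm_def power2_eq_square mult.assoc)
      thus ?thesis by (simp only: pos_divide_le_eq[OF pos])
    qed simp
    thus "\<forall>\<^sub>F h in at 0. norm (env (x + h) - env x - h \<bullet> ?D) / norm h \<le> ?C * norm h"
      by (intro always_eventually allI)
  qed simp
  thus ?thesis unfolding gderiv_def has_derivative_at
    by (intro conjI bounded_linear_inner_left)
qed

lemma gradient_env: "gradient env x = (1 / t) *\<^sub>R (x - prox x)"
  unfolding gradient_def
proof (rule the_equality)
  fix D assume "GDERIV env x :> D"
  hence "(\<lambda>h. h \<bullet> D) = (\<lambda>h. h \<bullet> ((1 / t) *\<^sub>R (x - prox x)))"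
    using GDERIV_env[of x] unfolding gderiv_def by (rule has_derivative_unique)
  hence "\<forall>h. h \<bullet> D = h \<bullet> ((1 / t) *\<^sub>R (x - prox x))" by (intro allI) (rule fun_cong)
  thus "D = (1 / t) *\<^sub>R (x - prox x)" by (simp only: vector_eq_ldot)
qed (rule GDERIV_env)

lemma norm_gradient_env: "norm (gradient env x) = 1 / t * norm (prox x - x)"
  using t_pos by (simp add: gradient_env norm_minus_commute)

lemma continuous_env: "continuous_on UNIV env"
  using GDERIV_env unfolding gderiv_def
  by (blast intro: continuous_at_imp_continuous_on has_derivative_continuous)

lemma f_prox_le: "x \<in> X \<Longrightarrow> f (prox x) \<le> f x - 1 / (2 * t) * (norm (prox x - x))\<^sup>2"
  using prox_min[of x x] by (simp add: prox_objective_def)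

lemma norm_prox_diff_le:
  assumes "x \<in> X" and "f (prox x) \<ge> f x - L * norm (prox x - x) - \<rho> / 2 * (norm (prox x - x))\<^sup>2"
    and "L \<ge> 0"
  shows "norm (prox x - x) \<le> L / ((1 / t - \<rho>) / 2)"
proof -
  let ?d = "norm (prox x - x)"
  have "?d * ((1 / t - \<rho>) / 2 * ?d) \<le> ?d * L"
    using f_prox_le[OF assms(1)] assms(2) by (simp add: power2_eq_square field_simps)
  hence "(1 / t - \<rho>) / 2 * ?d \<le> L"
    using assms(3) by (cases "?d = 0") (auto simp: mult_le_cancel_left)
  thus ?thesis using \<rho>_less by (simp add: pos_le_divide_eq mult.commute)
qed

end

section \<open>Square integrability with respect to a weight\<close>

text \<open>A probability space with a measurable weight in \<open>[0, 1]\<close>. The weight will be the indicator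
  of an initial event, on which the initial points are bounded.\<close>

locale weighted_prob_space = prob_space M for M :: "'w measure" +
  fixes b :: "'w \<Rightarrow> real"
  assumes b_measurable [measurable]: "b \<in> borel_measurable M"
    and b_nonneg: "b \<omega> \<ge> 0" and b_le_1: "b \<omega> \<le> 1"
begin

text \<open>Square integrability of a random vector for the measure with density \<open>b\<close>.\<close>

definition sq_integrable :: "('w \<Rightarrow> 'b::euclidean_space) \<Rightarrow> bool" where
  "sq_integrable Y \<longleftrightarrow> Y \<in> borel_measurable M \<and> integrable M (\<lambda>\<omega>. b \<omega> * (norm (Y \<omega>))\<^sup>2)"

lemma sq_integrable_measurable: "sq_integrable Y \<Longrightarrow> Y \<in> borel_measurable M"
  by (simp add: sq_integrable_def)

lemma sq_integrable_bound:
  assumes Y: "sq_integrable Y" and Z: "Z \<in> borel_measurable M"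
    and le: "\<And>\<omega>. \<omega> \<in> space M \<Longrightarrow> norm (Z \<omega>) \<le> norm (Y \<omega>)"
  shows "sq_integrable Z"
proof -
  have "integrable M (\<lambda>\<omega>. b \<omega> * (norm (Z \<omega>))\<^sup>2)"
  proof (rule Bochner_Integration.integrable_bound)
    show "integrable M (\<lambda>\<omega>. b \<omega> * (norm (Y \<omega>))\<^sup>2)" using Y by (simp add: sq_integrable_def)
    show "AE \<omega> in M. norm (b \<omega> * (norm (Z \<omega>))\<^sup>2) \<le> norm (b \<omega> * (norm (Y \<omega>))\<^sup>2)"
      using le b_nonneg by (intro AE_I2) (auto simp: abs_mult intro!: mult_left_mono power_mono)
  qed (use Z in measurable)
  thus ?thesis using Z by (simp add: sq_integrable_def)
qed

lemma sq_integrable_add: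
  assumes "sq_integrable Y" "sq_integrable Z"
  shows "sq_integrable (\<lambda>\<omega>. Y \<omega> + Z \<omega>)"
proof -
  have [measurable]: "Y \<in> borel_measurable M" "Z \<in> borel_measurable M"
    using assms by (auto simp: sq_integrable_def)
  have "integrable M (\<lambda>\<omega>. b \<omega> * (norm (Y \<omega> + Z \<omega>))\<^sup>2)"
  proof (rule Bochner_Integration.integrable_bound)
    show "integrable M (\<lambda>\<omega>. 2 * (b \<omega> * (norm (Y \<omega>))\<^sup>2) + 2 * (b \<omega> * (norm (Z \<omega>))\<^sup>2))"
      using assms by (simp add: sq_integrable_def)
    have "b \<omega> * (norm (Y \<omega> + Z \<omega>))\<^sup>2 \<le> 2 * (b \<omega> * (norm (Y \<omega>))\<^sup>2) + 2 * (b \<omega> * (norm (Z \<omega>))\<^sup>2)" for \<omega>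
      using mult_left_mono[OF norm_add_sq_le2[of "Y \<omega>" "Z \<omega>"] b_nonneg[of \<omega>]]
      by (simp add: algebra_simps)
    thus "AE \<omega> in M. norm (b \<omega> * (norm (Y \<omega> + Z \<omega>))\<^sup>2)
        \<le> norm (2 * (b \<omega> * (norm (Y \<omega>))\<^sup>2) + 2 * (b \<omega> * (norm (Z \<omega>))\<^sup>2))"
      using b_nonneg by (intro AE_I2) (auto simp: abs_mult)
  qed measurable
  thus ?thesis by (simp add: sq_integrable_def)
qed

lemma sq_integrable_scaleR:
  assumes "sq_integrable Y"
  shows "sq_integrable (\<lambda>\<omega>. c *\<^sub>R Y \<omega>)"
proof -
  have "integrable M (\<lambda>\<omega>. c\<^sup>2 * (b \<omega> * (norm (Y \<omega>))\<^sup>2))"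
    using assms by (auto simp: sq_integrable_def)
  thus ?thesis using assms by (auto simp: sq_integrable_def power_mult_distrib mult_ac)
qed

lemma sq_integrable_diff:
  assumes "sq_integrable Y" "sq_integrable Z"
  shows "sq_integrable (\<lambda>\<omega>. Y \<omega> - Z \<omega>)"
  using sq_integrable_add[OF assms(1) sq_integrable_scaleR[OF assms(2), of "-1"]] by simp

lemma sq_integrable_sum:
  assumes "\<And>i. i \<in> I \<Longrightarrow> sq_integrable (Y i)"
  shows "sq_integrable (\<lambda>\<omega>. \<Sum>i\<in>I. Y i \<omega>)"
  using assms
proof (induction I rule: infinite_finite_induct)
  case (insert i I)
  thus ?case using sq_integrable_add[of "Y i" "\<lambda>\<omega>. \<Sum>i\<in>I. Y i \<omega>"] by simp
qed (auto simp: sq_integrable_def)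

lemma sq_integrable_average:
  assumes "\<And>i::'v::finite. sq_integrable (Y i)"
  shows "sq_integrable (\<lambda>\<omega>. average (\<lambda>i. Y i \<omega>))"
  unfolding average_def by (intro sq_integrable_scaleR sq_integrable_sum assms)

lemma integrable_weighted_bounded:
  fixes Y :: "'w \<Rightarrow> real"
  assumes [measurable]: "Y \<in> borel_measurable M" and "\<And>\<omega>. \<omega> \<in> space M \<Longrightarrow> \<bar>Y \<omega>\<bar> \<le> c"
  shows "integrable M (\<lambda>\<omega>. b \<omega> * Y \<omega>)"
proof (rule integrable_const_bound[where B=c])
  show "AE \<omega> in M. norm (b \<omega> * Y \<omega>) \<le> c"
  proof (rule AE_I2)
    fix \<omega> assume "\<omega> \<in> space M"
    have "b \<omega> * \<bar>Y \<omega>\<bar> \<le> \<bar>Y \<omega>\<bar>" using b_le_1[of \<omega>] b_nonneg[of \<omega>] by (intro mult_left_le_one_le) auto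
    also have "\<dots> \<le> c" by (rule assms) fact
    finally show "norm (b \<omega> * Y \<omega>) \<le> c" using b_nonneg[of \<omega>] by (simp add: abs_mult)
  qed
qed measurable

lemma sq_integrable_bounded:
  assumes Y: "Y \<in> borel_measurable M" and le: "\<And>\<omega>. \<omega> \<in> space M \<Longrightarrow> norm (Y \<omega>) \<le> c"
  shows "sq_integrable Y"
proof -
  have "integrable M (\<lambda>\<omega>. b \<omega> * (norm (Y \<omega>))\<^sup>2)"
    using Y le by (intro integrable_weighted_bounded[where c="c\<^sup>2"]) (auto intro: power_mono)
  thus ?thesis using Y by (simp add: sq_integrable_def)
qed

lemma integrable_inner:
  assumes "sq_integrable Y" "sq_integrable Z"
  shows "integrable M (\<lambda>\<omega>. b \<omega> * (Y \<omega> \<bullet> Z \<omega>))"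
proof (rule Bochner_Integration.integrable_bound)
  have [measurable]: "Y \<in> borel_measurable M" "Z \<in> borel_measurable M"
    using assms by (auto simp: sq_integrable_def)
  show "(\<lambda>\<omega>. b \<omega> * (Y \<omega> \<bullet> Z \<omega>)) \<in> borel_measurable M" by measurable
  show "integrable M (\<lambda>\<omega>. b \<omega> * (norm (Y \<omega>))\<^sup>2 + b \<omega> * (norm (Z \<omega>))\<^sup>2)"
    using assms by (simp add: sq_integrable_def)
  have "b \<omega> * \<bar>Y \<omega> \<bullet> Z \<omega>\<bar> \<le> b \<omega> * (norm (Y \<omega>))\<^sup>2 + b \<omega> * (norm (Z \<omega>))\<^sup>2" for \<omega>
  proof -
    have "\<bar>Y \<omega> \<bullet> Z \<omega>\<bar> \<le> norm (Y \<omega>) * norm (Z \<omega>)" by (rule Cauchy_Schwarz_ineq2)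
    also have "\<dots> \<le> (norm (Y \<omega>))\<^sup>2 + (norm (Z \<omega>))\<^sup>2"
      using sum_squares_bound[of "norm (Y \<omega>)" "norm (Z \<omega>)"]
        mult_nonneg_nonneg[OF norm_ge_zero[of "Y \<omega>"] norm_ge_zero[of "Z \<omega>"]] by linarith
    finally show ?thesis
      unfolding distrib_left[symmetric] by (intro mult_left_mono b_nonneg)
  qed
  thus "AE \<omega> in M. norm (b \<omega> * (Y \<omega> \<bullet> Z \<omega>))
      \<le> norm (b \<omega> * (norm (Y \<omega>))\<^sup>2 + b \<omega> * (norm (Z \<omega>))\<^sup>2)"
    using b_nonneg by (intro AE_I2) (auto simp: abs_mult)
qed

lemma integrable_dispersion:
  fixes Y :: "'v::finite \<Rightarrow> 'w \<Rightarrow> 'b::euclidean_space"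
  assumes "\<And>i. sq_integrable (Y i)"
  shows "integrable M (\<lambda>\<omega>. b \<omega> * dispersion (\<lambda>i. Y i \<omega>))"
proof -
  have "sq_integrable (\<lambda>\<omega>. Y i \<omega> - average (\<lambda>i. Y i \<omega>))" for i
    by (intro sq_integrable_diff sq_integrable_average assms)
  thus ?thesis
    by (auto simp: dispersion_def sum_distrib_left sq_integrable_def)
qed

text \<open>The weight and the first factor are \<open>F\<close>-measurable, hence the second factor may be
  replaced by its conditional expectation.\<close>

lemma integral_inner_vec_cond_exp:
  fixes Y Z :: "'w \<Rightarrow> 'b::euclidean_space"
  assumes F: "subalgebra M F" and b: "b \<in> borel_measurable F" and YF: "Y \<in> borel_measurable F"
    and Y: "sq_integrable Y" and Z: "sq_integrable Z"
  shows "integrable M (\<lambda>\<omega>. b \<omega> * (Y \<omega> \<bullet> vec_cond_exp M F Z \<omega>))"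
    and "(\<integral>\<omega>. b \<omega> * (Y \<omega> \<bullet> vec_cond_exp M F Z \<omega>) \<partial>M) = (\<integral>\<omega>. b \<omega> * (Y \<omega> \<bullet> Z \<omega>) \<partial>M)"
proof -
  interpret finite_measure_subalgebra M F by standard (rule F)
  note [measurable] = b YF sq_integrable_measurable[OF Y] sq_integrable_measurable[OF Z]
  let ?G = "\<lambda>e. real_cond_exp M F (\<lambda>\<omega>. Z \<omega> \<bullet> e)"
  have cond: "vec_cond_exp M F Z \<omega> \<bullet> e = ?G e \<omega>" if "e \<in> Basis" for e \<omega>
    using that by (simp add: vec_cond_exp_def)
  have sq: "sq_integrable (\<lambda>\<omega>. U \<omega> \<bullet> e)" if "e \<in> Basis" "sq_integrable U" for e and U :: "'w \<Rightarrow> 'b"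
    using that
    by (intro sq_integrable_bound[OF that(2)])
      (auto dest: sq_integrable_measurable simp: Basis_le_norm)
  have int: "integrable M (\<lambda>\<omega>. (b \<omega> * (Y \<omega> \<bullet> e)) * (Z \<omega> \<bullet> e))" if "e \<in> Basis" for e
    using integrable_inner[OF sq[OF that Y] sq[OF that Z]] by (simp add: mult.assoc)
  note ce = real_cond_exp_intg[OF int]
  have Gsum: "b \<omega> * (Y \<omega> \<bullet> vec_cond_exp M F Z \<omega>) = (\<Sum>e\<in>Basis. (b \<omega> * (Y \<omega> \<bullet> e)) * ?G e \<omega>)" for \<omega>
    by (subst euclidean_inner) (simp add: cond sum_distrib_left mult.assoc)
  have Zsum: "b \<omega> * (Y \<omega> \<bullet> Z \<omega>) = (\<Sum>e\<in>Basis. (b \<omega> * (Y \<omega> \<bullet> e)) * (Z \<omega> \<bullet> e))" for \<omega>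
    by (subst euclidean_inner) (simp add: sum_distrib_left mult.assoc)
  show "integrable M (\<lambda>\<omega>. b \<omega> * (Y \<omega> \<bullet> vec_cond_exp M F Z \<omega>))"
    unfolding Gsum by (intro Bochner_Integration.integrable_sum ce(1)) measurable
  have "(\<integral>\<omega>. b \<omega> * (Y \<omega> \<bullet> vec_cond_exp M F Z \<omega>) \<partial>M)
      = (\<Sum>e\<in>Basis. \<integral>\<omega>. (b \<omega> * (Y \<omega> \<bullet> e)) * ?G e \<omega> \<partial>M)"
    unfolding Gsum by (intro Bochner_Integration.integral_sum ce(1)) measurable
  also have "\<dots> = (\<Sum>e\<in>Basis. \<integral>\<omega>. (b \<omega> * (Y \<omega> \<bullet> e)) * (Z \<omega> \<bullet> e) \<partial>M)"
    by (intro sum.cong refl ce(2)) measurable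
  also have "\<dots> = (\<integral>\<omega>. b \<omega> * (Y \<omega> \<bullet> Z \<omega>) \<partial>M)"
    unfolding Zsum by (intro Bochner_Integration.integral_sum[symmetric] int)
  finally show "(\<integral>\<omega>. b \<omega> * (Y \<omega> \<bullet> vec_cond_exp M F Z \<omega>) \<partial>M) = (\<integral>\<omega>. b \<omega> * (Y \<omega> \<bullet> Z \<omega>) \<partial>M)" .
qed

end

section \<open>One step of the method\<close>

text \<open>The assumptions under which a single step can be analysed: those on the problem and on the
  iterates, doubly stochastic weights and positive stepsizes. Connectivity of the network and the
  limiting behaviour of the stepsizes are not included.\<close>

locale subgradient_method =
  prob_space M + weakly_convex_problem X f \<rho> t
  for M :: "'w measure" and X :: "'a::euclidean_space set" and f :: "'a \<Rightarrow> real" and \<rho> t :: real +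
  fixes fi :: "'v::finite \<Rightarrow> 'a \<Rightarrow> real" and A :: "nat \<Rightarrow> 'v \<Rightarrow> 'v \<Rightarrow> real"
    and \<alpha> :: "nat \<Rightarrow> real" and F :: "nat \<Rightarrow> 'w measure" and \<xi> x :: "'v \<Rightarrow> nat \<Rightarrow> 'w \<Rightarrow> 'a"
    and L :: real
  assumes f_eq: "f = (\<lambda>y. average (\<lambda>i. fi i y))"
    and ds: "\<And>k. doubly_stochastic (A k)"
    and \<rho>_pos: "\<rho> > 0" and weakly_convex_fi: "\<And>i. weakly_convex \<rho> (fi i)"
    and subgradient_bound: "\<And>i y g. y \<in> X \<Longrightarrow> g \<in> subdifferential \<rho> (fi i) y \<Longrightarrow> norm g \<le> L"
    and \<alpha>_pos: "\<And>k. \<alpha> k > 0"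
    and method_iterates: "stochastic_subgradient_method M F X \<rho> L fi A \<alpha> \<xi> x"
begin

text \<open>\<open>v i k\<close> is the mixed point of agent \<open>i\<close>, \<open>xbar k\<close> the average iterate, \<open>p k\<close> its
  proximal point, \<open>d k\<close> the distance of the latter two (\<open>t\<close> times the norm of the gradient), and
  \<open>disp k\<close> the consensus error.\<close>

abbreviation "v i k \<omega> \<equiv> \<Sum>j\<in>UNIV. A k i j *\<^sub>R x j k \<omega>"
abbreviation "xbar k \<omega> \<equiv> average (\<lambda>i. x i k \<omega>)"
abbreviation "p k \<omega> \<equiv> prox (xbar k \<omega>)"
abbreviation "d k \<omega> \<equiv> norm (p k \<omega> - xbar k \<omega>)"
abbreviation "disp k \<omega> \<equiv> dispersion (\<lambda>i. x i k \<omega>)"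

lemma A_nonneg: "A k i j \<ge> 0" and A_row: "(\<Sum>j\<in>UNIV. A k i j) = 1"
  using ds by (auto simp: doubly_stochastic_def)

lemma mixed_eq: "mixed A x i k \<omega> = v i k \<omega>"
proof -
  have "A k i j = 0" if "j \<notin> in_neighbours A k i" for j
    using that A_nonneg[of k i j] by (simp add: in_neighbours_def)
  thus ?thesis unfolding mixed_def by (intro sum.mono_neutral_left) auto
qed

lemma filtration_F: "filtration (space M) F" and subalgebra_F: "subalgebra M (F k)"
  and x_adapted: "x i k \<in> borel_measurable (F k)"
  and \<xi>_measurable: "\<xi> i k \<in> borel_measurable M"
  and \<xi>_integrable: "integrable M (\<lambda>\<omega>. (norm (\<xi> i k \<omega>))\<^sup>2)"
  and \<xi>_bound: "(\<integral>\<omega>. (norm (\<xi> i k \<omega>))\<^sup>2 \<partial>M) \<le> L\<^sup>2"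
  and \<xi>_subgradient:
    "AE \<omega> in M. vec_cond_exp M (F k) (\<xi> i k) \<omega> \<in> subdifferential \<rho> (fi i) (v i k \<omega>)"
  and x_0: "\<omega> \<in> space M \<Longrightarrow> x i 0 \<omega> \<in> X"
  and x_Suc: "\<omega> \<in> space M \<Longrightarrow> x i (Suc k) \<omega> = closest_point X (v i k \<omega> - \<alpha> k *\<^sub>R \<xi> i k \<omega>)"
  using method_iterates by (auto simp: stochastic_subgradient_method_def mixed_eq)

lemma x_measurable: "x i k \<in> borel_measurable M"
  by (rule measurable_from_subalg[OF subalgebra_F x_adapted])

lemma x_in: "\<omega> \<in> space M \<Longrightarrow> x i k \<omega> \<in> X"
  by (cases k) (auto simp: x_0 x_Suc intro!: closest_point_in_set closed_X X_nonempty)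

lemma v_in: "\<omega> \<in> space M \<Longrightarrow> v i k \<omega> \<in> X"
  using convex_X by (intro convex_sum) (auto simp: A_nonneg A_row x_in)

lemma xbar_in: "\<omega> \<in> space M \<Longrightarrow> xbar k \<omega> \<in> X"
  unfolding average_def scaleR_sum_right
  using convex_X by (intro convex_sum) (auto simp: x_in)

lemma x_Suc_near: "\<omega> \<in> space M \<Longrightarrow> norm (x i (Suc k) \<omega> - v i k \<omega>) \<le> \<alpha> k * norm (\<xi> i k \<omega>)"
  using closest_point_lipschitz[OF convex_X closed_X X_nonempty, of "v i k \<omega> - \<alpha> k *\<^sub>R \<xi> i k \<omega>" "v i k \<omega>"]
    closest_point_self[OF v_in] \<alpha>_pos[of k]
  by (simp add: x_Suc dist_norm)

lemma x_Suc_dist: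
  "\<omega> \<in> space M \<Longrightarrow> y \<in> X \<Longrightarrow> norm (x i (Suc k) \<omega> - y) \<le> norm (v i k \<omega> - \<alpha> k *\<^sub>R \<xi> i k \<omega> - y)"
  using closest_point_lipschitz[OF convex_X closed_X X_nonempty, of "v i k \<omega> - \<alpha> k *\<^sub>R \<xi> i k \<omega>" y]
    closest_point_self[of y X]
  by (simp add: x_Suc dist_norm)

lemma L_nonneg: "L \<ge> 0"
proof -
  obtain y g where "y \<in> X" "g \<in> subdifferential \<rho> (fi undefined) y"
    using X_nonempty subdifferential_nonempty[OF weakly_convex_fi] by blast
  thus ?thesis using subgradient_bound norm_ge_zero order_trans by blast
qed

text \<open>The subgradient bound at \<open>y \<in> X\<close> acts as a one-sided Lipschitz condition, up to the
  quadratic term of weak convexity.\<close>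

lemma fi_lower:
  assumes "y \<in> X"
  shows "fi i z \<ge> fi i y - L * norm (z - y) - \<rho> / 2 * (norm (z - y))\<^sup>2"
proof -
  obtain g where g: "g \<in> subdifferential \<rho> (fi i) y"
    using subdifferential_nonempty[OF weakly_convex_fi] by blast
  have "- (g \<bullet> (z - y)) \<le> norm g * norm (z - y)" using Cauchy_Schwarz_ineq2[of g "z - y"] by linarith
  also have "\<dots> \<le> L * norm (z - y)"
    by (intro mult_right_mono subgradient_bound[OF assms g] norm_ge_zero)
  finally show ?thesis using subdifferential_ineq[OF g, of z] by linarith
qed

lemma f_lower:
  assumes "y \<in> X"
  shows "f z \<ge> f y - L * norm (z - y) - \<rho> / 2 * (norm (z - y))\<^sup>2"
proof -
  let ?c = "L * norm (z - y) + \<rho> / 2 * (norm (z - y))\<^sup>2"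
  have "(\<Sum>i\<in>UNIV. fi i y - ?c) \<le> (\<Sum>i\<in>UNIV. fi i z)"
    using fi_lower[OF assms] by (intro sum_mono) (simp add: algebra_simps)
  hence "(\<Sum>i\<in>UNIV. fi i y) - real CARD('v) * ?c \<le> (\<Sum>i\<in>UNIV. fi i z)" by (simp add: sum_subtractf)
  hence "((\<Sum>i\<in>UNIV. fi i y) - real CARD('v) * ?c) / real CARD('v) \<le> (\<Sum>i\<in>UNIV. fi i z) / real CARD('v)"
    by (rule divide_right_mono) simp
  thus ?thesis by (simp add: f_eq average_def diff_divide_distrib)
qed

lemma d_bounded: "\<omega> \<in> space M \<Longrightarrow> d k \<omega> \<le> L / ((1 / t - \<rho>) / 2)"
  by (intro norm_prox_diff_le xbar_in f_lower L_nonneg)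

lemma v_average: "average (\<lambda>i. v i k \<omega>) = xbar k \<omega>"
  by (rule average_doubly_stochastic[OF ds])

lemma sum_v_norm_sq_le:
  "(\<Sum>i\<in>UNIV. (norm (v i k \<omega> - y))\<^sup>2) \<le> disp k \<omega> + real CARD('v) * (norm (xbar k \<omega> - y))\<^sup>2"
  using sum_norm_sq_shift[of "\<lambda>i. v i k \<omega>" y] dispersion_doubly_stochastic_le[OF ds, of k "\<lambda>i. x i k \<omega>"]
  by (simp add: v_average)

text \<open>Insert the proximal point of the old average into the envelope at the new average, and use
  that the projection onto \<open>X\<close> is nonexpansive and fixes the proximal point.\<close>

lemma env_step:
  assumes \<omega>: "\<omega> \<in> space M"
  shows "env (xbar (Suc k) \<omega>) \<le> env (xbar k \<omega>) + disp k \<omega> / (2 * t * real CARD('v))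
    + \<alpha> k / (t * real CARD('v)) * (\<Sum>i\<in>UNIV. (p k \<omega> - v i k \<omega>) \<bullet> \<xi> i k \<omega>)
    + (\<alpha> k)\<^sup>2 / (2 * t * real CARD('v)) * (\<Sum>i\<in>UNIV. (norm (\<xi> i k \<omega>))\<^sup>2)"
proof -
  let ?p = "p k \<omega>" and ?S = "\<Sum>i\<in>UNIV. (p k \<omega> - v i k \<omega>) \<bullet> \<xi> i k \<omega>"
    and ?Q = "\<Sum>i\<in>UNIV. (norm (\<xi> i k \<omega>))\<^sup>2"
  have "real CARD('v) * (norm (xbar (Suc k) \<omega> - ?p))\<^sup>2 \<le> (\<Sum>i\<in>UNIV. (norm (x i (Suc k) \<omega> - ?p))\<^sup>2)"
    using sum_norm_sq_shift[of "\<lambda>i. x i (Suc k) \<omega>" ?p] dispersion_nonneg[of "\<lambda>i. x i (Suc k) \<omega>"]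
    by simp
  also have "\<dots> \<le> (\<Sum>i\<in>UNIV. (norm (v i k \<omega> - \<alpha> k *\<^sub>R \<xi> i k \<omega> - ?p))\<^sup>2)"
    by (intro sum_mono power_mono x_Suc_dist \<omega> prox_in norm_ge_zero)
  also have "\<dots> = (\<Sum>i\<in>UNIV. (norm (v i k \<omega> - ?p))\<^sup>2 + 2 * \<alpha> k * ((?p - v i k \<omega>) \<bullet> \<xi> i k \<omega>)
      + (\<alpha> k)\<^sup>2 * (norm (\<xi> i k \<omega>))\<^sup>2)"
  proof (rule sum.cong[OF refl])
    fix i
    have "(norm (u - a *\<^sub>R w - q))\<^sup>2 = (norm (u - q))\<^sup>2 + 2 * a * ((q - u) \<bullet> w) + a\<^sup>2 * (norm w)\<^sup>2"
      for u w q :: 'a and a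
      by (simp add: power2_norm_eq_inner inner_diff_left inner_diff_right inner_commute)
        (simp add: power2_eq_square algebra_simps)
    thus "(norm (v i k \<omega> - \<alpha> k *\<^sub>R \<xi> i k \<omega> - ?p))\<^sup>2 = (norm (v i k \<omega> - ?p))\<^sup>2
      + 2 * \<alpha> k * ((?p - v i k \<omega>) \<bullet> \<xi> i k \<omega>) + (\<alpha> k)\<^sup>2 * (norm (\<xi> i k \<omega>))\<^sup>2" .
  qed
  also have "\<dots> = (\<Sum>i\<in>UNIV. (norm (v i k \<omega> - ?p))\<^sup>2) + 2 * \<alpha> k * ?S + (\<alpha> k)\<^sup>2 * ?Q"
    by (simp add: sum.distrib sum_distrib_left)
  also have "\<dots> \<le> disp k \<omega> + real CARD('v) * (norm (xbar k \<omega> - ?p))\<^sup>2 + 2 * \<alpha> k * ?S + (\<alpha> k)\<^sup>2 * ?Q"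
    using sum_v_norm_sq_le[of k \<omega> ?p] by simp
  finally have "real CARD('v) * (norm (xbar (Suc k) \<omega> - ?p))\<^sup>2 / (2 * t * real CARD('v))
     \<le> (disp k \<omega> + real CARD('v) * (norm (xbar k \<omega> - ?p))\<^sup>2 + 2 * \<alpha> k * ?S + (\<alpha> k)\<^sup>2 * ?Q) / (2 * t * real CARD('v))"
    using t_pos by (intro divide_right_mono) auto
  hence "1 / (2 * t) * (norm (?p - xbar (Suc k) \<omega>))\<^sup>2 \<le> 1 / (2 * t) * (norm (?p - xbar k \<omega>))\<^sup>2
     + disp k \<omega> / (2 * t * real CARD('v)) + \<alpha> k / (t * real CARD('v)) * ?S + (\<alpha> k)\<^sup>2 / (2 * t * real CARD('v)) * ?Q"
    by (simp add: add_divide_distrib norm_minus_commute algebra_simps)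
  thus ?thesis
    using env_le[OF prox_in, of "xbar (Suc k) \<omega>" "xbar k \<omega>"]
    unfolding env_eq[of "xbar k \<omega>"] prox_objective_def by linarith
qed

text \<open>For subgradients at the mixed points the averaged inner product is at most a negative
  multiple of the squared distance of \<open>xbar\<close> to its proximal point, up to the consensus error and
  a term that is quadratic in the stepsize.\<close>

lemma subgradient_inner_le:
  assumes \<omega>: "\<omega> \<in> space M"
    and g: "\<And>i. g i \<in> subdifferential \<rho> (fi i) (v i k \<omega>)"
  shows "\<alpha> k / real CARD('v) * (\<Sum>i\<in>UNIV. (p k \<omega> - v i k \<omega>) \<bullet> g i)
    \<le> - ((1 / t - \<rho>) / 2) * \<alpha> k * (d k \<omega>)\<^sup>2 + (\<alpha> k)\<^sup>2 * L\<^sup>2 / 2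
      + (1 / 2 + \<rho> * \<alpha> k) / real CARD('v) * disp k \<omega>"
proof -
  let ?p = "p k \<omega>" and ?x = "xbar k \<omega>" and ?a = "\<alpha> k"
  have v1: "(\<Sum>i\<in>UNIV. (norm (v i k \<omega> - ?x))\<^sup>2) \<le> disp k \<omega>"
    using sum_v_norm_sq_le[of k \<omega> ?x] by simp
  have v2: "(\<Sum>i\<in>UNIV. (norm (v i k \<omega> - ?p))\<^sup>2) \<le> disp k \<omega> + real CARD('v) * (d k \<omega>)\<^sup>2"
    using sum_v_norm_sq_le[of k \<omega> ?p] by (simp add: norm_minus_commute)
  have "?a * ((?p - v i k \<omega>) \<bullet> g i) \<le> ?a * (fi i ?p - fi i ?x) + ?a\<^sup>2 * L\<^sup>2 / 2
      + (1 / 2 + ?a * \<rho> / 2) * (norm (v i k \<omega> - ?x))\<^sup>2 + ?a * \<rho> / 2 * (norm (v i k \<omega> - ?p))\<^sup>2" for i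
  proof -
    have "(?p - v i k \<omega>) \<bullet> g i \<le> fi i ?p - fi i (v i k \<omega>) + \<rho> / 2 * (norm (v i k \<omega> - ?p))\<^sup>2"
      using subdifferential_ineq[OF g[of i], of ?p] by (simp add: inner_commute norm_minus_commute)
    moreover have "fi i (v i k \<omega>) \<ge> fi i ?x - L * norm (v i k \<omega> - ?x) - \<rho> / 2 * (norm (v i k \<omega> - ?x))\<^sup>2"
      by (rule fi_lower[OF xbar_in[OF \<omega>]])
    ultimately have "(?p - v i k \<omega>) \<bullet> g i \<le> fi i ?p - fi i ?x + L * norm (v i k \<omega> - ?x)
        + \<rho> / 2 * (norm (v i k \<omega> - ?x))\<^sup>2 + \<rho> / 2 * (norm (v i k \<omega> - ?p))\<^sup>2" by linarith
    hence "?a * ((?p - v i k \<omega>) \<bullet> g i) \<le> ?a * (fi i ?p - fi i ?x + L * norm (v i k \<omega> - ?x)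
        + \<rho> / 2 * (norm (v i k \<omega> - ?x))\<^sup>2 + \<rho> / 2 * (norm (v i k \<omega> - ?p))\<^sup>2)"
      using \<alpha>_pos[of k] by (intro mult_left_mono) auto
    \<comment> \<open>the linear consensus error is absorbed into quadratic ones\<close>
    moreover have "(?a * L) * norm (v i k \<omega> - ?x) \<le> (?a * L)\<^sup>2 / 2 + (norm (v i k \<omega> - ?x))\<^sup>2 / 2"
      using sum_squares_bound[of "?a * L" "norm (v i k \<omega> - ?x)"] by simp
    ultimately show ?thesis by (simp add: power_mult_distrib algebra_simps add_divide_distrib)
  qed
  hence "(\<Sum>i\<in>UNIV. ?a * ((?p - v i k \<omega>) \<bullet> g i)) \<le> (\<Sum>i\<in>UNIV. ?a * (fi i ?p - fi i ?x) + ?a\<^sup>2 * L\<^sup>2 / 2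
      + (1 / 2 + ?a * \<rho> / 2) * (norm (v i k \<omega> - ?x))\<^sup>2 + ?a * \<rho> / 2 * (norm (v i k \<omega> - ?p))\<^sup>2)"
    by (intro sum_mono)
  also have "\<dots> = ?a * ((\<Sum>i\<in>UNIV. fi i ?p) - (\<Sum>i\<in>UNIV. fi i ?x)) + real CARD('v) * (?a\<^sup>2 * L\<^sup>2 / 2)
      + (1 / 2 + ?a * \<rho> / 2) * (\<Sum>i\<in>UNIV. (norm (v i k \<omega> - ?x))\<^sup>2)
      + ?a * \<rho> / 2 * (\<Sum>i\<in>UNIV. (norm (v i k \<omega> - ?p))\<^sup>2)"
    by (simp only: sum.distrib sum_distrib_left[symmetric] sum_subtractf sum_constant)
  also have "(\<Sum>i\<in>UNIV. fi i ?p) - (\<Sum>i\<in>UNIV. fi i ?x) = real CARD('v) * (f ?p - f ?x)"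
    by (simp add: f_eq average_def field_simps)
  also have "?a * (real CARD('v) * (f ?p - f ?x)) + real CARD('v) * (?a\<^sup>2 * L\<^sup>2 / 2)
      + (1 / 2 + ?a * \<rho> / 2) * (\<Sum>i\<in>UNIV. (norm (v i k \<omega> - ?x))\<^sup>2)
      + ?a * \<rho> / 2 * (\<Sum>i\<in>UNIV. (norm (v i k \<omega> - ?p))\<^sup>2)
    \<le> ?a * (real CARD('v) * (- 1 / (2 * t) * (d k \<omega>)\<^sup>2)) + real CARD('v) * (?a\<^sup>2 * L\<^sup>2 / 2)
      + (1 / 2 + ?a * \<rho> / 2) * disp k \<omega> + ?a * \<rho> / 2 * (disp k \<omega> + real CARD('v) * (d k \<omega>)\<^sup>2)"
    using \<alpha>_pos[of k] \<rho>_pos f_prox_le[OF xbar_in[OF \<omega>], of k]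
    by (intro add_mono mult_left_mono v1 v2 order_refl) auto
  finally have "?a * (\<Sum>i\<in>UNIV. (?p - v i k \<omega>) \<bullet> g i) \<le>
    ?a * (real CARD('v) * (- 1 / (2 * t) * (d k \<omega>)\<^sup>2)) + real CARD('v) * (?a\<^sup>2 * L\<^sup>2 / 2)
      + (1 / 2 + ?a * \<rho> / 2) * disp k \<omega> + ?a * \<rho> / 2 * (disp k \<omega> + real CARD('v) * (d k \<omega>)\<^sup>2)"
    by (simp add: sum_distrib_left)
  hence "?a * (\<Sum>i\<in>UNIV. (?p - v i k \<omega>) \<bullet> g i) / real CARD('v) \<le>
    (?a * (real CARD('v) * (- 1 / (2 * t) * (d k \<omega>)\<^sup>2)) + real CARD('v) * (?a\<^sup>2 * L\<^sup>2 / 2)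
      + (1 / 2 + ?a * \<rho> / 2) * disp k \<omega> + ?a * \<rho> / 2 * (disp k \<omega> + real CARD('v) * (d k \<omega>)\<^sup>2)) / real CARD('v)"
    by (rule divide_right_mono) simp
  also have "\<dots> = - ((1 / t - \<rho>) / 2) * \<alpha> k * (d k \<omega>)\<^sup>2 + (\<alpha> k)\<^sup>2 * L\<^sup>2 / 2
      + (1 / 2 + \<rho> * \<alpha> k) / real CARD('v) * disp k \<omega>"
    by (simp add: add_divide_distrib diff_divide_distrib algebra_simps)
  finally show ?thesis by simp
qed

lemma v_adapted: "(\<lambda>\<omega>. v i k \<omega>) \<in> borel_measurable (F k)"
  using x_adapted by measurable

lemma xbar_adapted: "(\<lambda>\<omega>. xbar k \<omega>) \<in> borel_measurable (F k)"
  unfolding average_def using x_adapted by measurable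

lemma p_adapted: "(\<lambda>\<omega>. p k \<omega>) \<in> borel_measurable (F k)"
  by (rule measurable_compose[OF xbar_adapted borel_measurable_continuous_onI[OF continuous_prox]])

lemma env_adapted: "(\<lambda>\<omega>. env (xbar k \<omega>)) \<in> borel_measurable (F k)"
  by (rule measurable_compose[OF xbar_adapted borel_measurable_continuous_onI[OF continuous_env]])

lemmas adapted_measurable [measurable] =
  x_measurable \<xi>_measurable
  measurable_from_subalg[OF subalgebra_F v_adapted]
  measurable_from_subalg[OF subalgebra_F xbar_adapted]
  measurable_from_subalg[OF subalgebra_F p_adapted]
  measurable_from_subalg[OF subalgebra_F env_adapted]

end

section \<open>Weighted expectations\<close>

text \<open>The initial points need not be square integrable, hence neither the consensus error nor
  the envelope need have an expectation. All expectations are therefore taken with a weight that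
  is measurable at time \<open>0\<close> and makes the initial points square integrable.\<close>

locale weighted_subgradient_method =
  subgradient_method M X f \<rho> t fi A \<alpha> F \<xi> x L + weighted_prob_space M b
  for M :: "'w measure" and X :: "'a::euclidean_space set" and f :: "'a \<Rightarrow> real" and \<rho> t :: real
    and fi :: "'v::finite \<Rightarrow> 'a \<Rightarrow> real" and A :: "nat \<Rightarrow> 'v \<Rightarrow> 'v \<Rightarrow> real"
    and \<alpha> :: "nat \<Rightarrow> real" and F :: "nat \<Rightarrow> 'w measure" and \<xi> x :: "'v \<Rightarrow> nat \<Rightarrow> 'w \<Rightarrow> 'a"
    and L :: real and b :: "'w \<Rightarrow> real" +
  assumes b_initial: "b \<in> borel_measurable (F 0)"
    and x_0_sq_integrable: "\<And>i. integrable M (\<lambda>\<omega>. b \<omega> * (norm (x i 0 \<omega>))\<^sup>2)"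
begin

lemma b_adapted: "b \<in> borel_measurable (F k)"
proof -
  have "subalgebra (F k) (F 0)"
    using filtration.space_F[OF filtration_F] filtration.sets_F_mono[OF filtration_F, of 0 k]
    by (auto simp: subalgebra_def)
  thus ?thesis using b_initial by (rule measurable_from_subalg)
qed

lemma \<xi>_weighted: "integrable M (\<lambda>\<omega>. b \<omega> * (norm (\<xi> i k \<omega>))\<^sup>2)"
  "(\<integral>\<omega>. b \<omega> * (norm (\<xi> i k \<omega>))\<^sup>2 \<partial>M) \<le> L\<^sup>2"
proof -
  have le: "b \<omega> * (norm (\<xi> i k \<omega>))\<^sup>2 \<le> (norm (\<xi> i k \<omega>))\<^sup>2" for \<omega>
    using b_le_1[of \<omega>] b_nonneg[of \<omega>] by (intro mult_left_le_one_le) auto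
  show int: "integrable M (\<lambda>\<omega>. b \<omega> * (norm (\<xi> i k \<omega>))\<^sup>2)"
    by (rule Bochner_Integration.integrable_bound[OF \<xi>_integrable[of i k]])
      (use le b_nonneg in \<open>auto simp: abs_mult\<close>)
  have "(\<integral>\<omega>. b \<omega> * (norm (\<xi> i k \<omega>))\<^sup>2 \<partial>M) \<le> (\<integral>\<omega>. (norm (\<xi> i k \<omega>))\<^sup>2 \<partial>M)"
    by (intro integral_mono int \<xi>_integrable le)
  thus "(\<integral>\<omega>. b \<omega> * (norm (\<xi> i k \<omega>))\<^sup>2 \<partial>M) \<le> L\<^sup>2" using \<xi>_bound[of i k] by linarith
qed

lemma sq_integrable_\<xi>: "sq_integrable (\<xi> i k)"
  by (simp add: sq_integrable_def \<xi>_weighted)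

text \<open>A step moves the mixed point by at most \<open>\<alpha> k * norm (\<xi> i k \<omega>)\<close>.\<close>

lemma sq_integrable_x: "sq_integrable (x i k)"
proof (induction k arbitrary: i)
  case 0
  show ?case by (simp add: sq_integrable_def x_0_sq_integrable)
next
  case (Suc k)
  have v: "sq_integrable (\<lambda>\<omega>. v i k \<omega>)"
    by (intro sq_integrable_sum sq_integrable_scaleR Suc)
  have "sq_integrable (\<lambda>\<omega>. x i (Suc k) \<omega> - v i k \<omega>)"
    by (rule sq_integrable_bound[OF sq_integrable_scaleR[OF sq_integrable_\<xi>[of i k], of "\<alpha> k"]])
      (use x_Suc_near \<alpha>_pos[of k] in auto)
  from sq_integrable_add[OF this v] show ?case by simp
qed

lemma sq_integrable_v: "sq_integrable (\<lambda>\<omega>. v i k \<omega>)"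
  by (intro sq_integrable_sum sq_integrable_scaleR sq_integrable_x)

lemma sq_integrable_xbar: "sq_integrable (\<lambda>\<omega>. xbar k \<omega>)"
  by (intro sq_integrable_average sq_integrable_x)

lemma sq_integrable_d: "sq_integrable (\<lambda>\<omega>. p k \<omega> - xbar k \<omega>)"
  by (rule sq_integrable_bounded[OF _ d_bounded]) measurable

lemma sq_integrable_p_v: "sq_integrable (\<lambda>\<omega>. p k \<omega> - v i k \<omega>)"
  using sq_integrable_add[OF sq_integrable_d[of k]
      sq_integrable_diff[OF sq_integrable_xbar[of k] sq_integrable_v[of k i]]]
  by simp

lemma integrable_env: "integrable M (\<lambda>\<omega>. b \<omega> * env (xbar k \<omega>))"
proof -
  obtain l where l: "\<And>y. l \<le> f y" using bdd_below_f by (auto simp: bdd_below_def)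
  obtain y where y: "y \<in> X" using X_nonempty by blast
  have upper: "env z \<le> f y + 1 / (2 * t) * (norm (z - y))\<^sup>2" for z
    using env_le[OF y, of z] by (simp add: norm_minus_commute)
  have lower: "env z \<ge> l" for z
    using l[of "prox z"] t_pos by (simp add: env_eq prox_objective_def add_increasing2)
  have const: "integrable M (\<lambda>\<omega>. b \<omega> * c)" for c
    by (rule integrable_weighted_bounded[of "\<lambda>_. c" "\<bar>c\<bar>"]) auto
  have "integrable M (\<lambda>\<omega>. b \<omega> * (norm (xbar k \<omega> - y))\<^sup>2)"
    using sq_integrable_diff[OF sq_integrable_xbar sq_integrable_bounded[of "\<lambda>_. y" "norm y"]]
    by (simp add: sq_integrable_def)
  hence "integrable M (\<lambda>\<omega>. b \<omega> * (\<bar>l\<bar> + \<bar>f y\<bar>) + 1 / (2 * t) * (b \<omega> * (norm (xbar k \<omega> - y))\<^sup>2))"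
    by (intro Bochner_Integration.integrable_add const integrable_mult_right)
  thus ?thesis
  proof (rule Bochner_Integration.integrable_bound)
    have "norm (b \<omega> * env (xbar k \<omega>)) \<le> norm (b \<omega> * (\<bar>l\<bar> + \<bar>f y\<bar>) + 1 / (2 * t) * (b \<omega> * (norm (xbar k \<omega> - y))\<^sup>2))" for \<omega>
    proof -
      have nn: "0 \<le> 1 / (2 * t) * (norm (xbar k \<omega> - y))\<^sup>2" using t_pos by simp
      have "\<bar>env (xbar k \<omega>)\<bar> \<le> \<bar>l\<bar> + \<bar>f y\<bar> + 1 / (2 * t) * (norm (xbar k \<omega> - y))\<^sup>2"
        using upper[of "xbar k \<omega>"] lower[of "xbar k \<omega>"] nn by linarith
      hence "b \<omega> * \<bar>env (xbar k \<omega>)\<bar> \<le> b \<omega> * (\<bar>l\<bar> + \<bar>f y\<bar> + 1 / (2 * t) * (norm (xbar k \<omega> - y))\<^sup>2)"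
        by (intro mult_left_mono b_nonneg)
      also have "\<dots> = b \<omega> * (\<bar>l\<bar> + \<bar>f y\<bar>) + 1 / (2 * t) * (b \<omega> * (norm (xbar k \<omega> - y))\<^sup>2)"
        by (simp add: algebra_simps)
      finally show ?thesis using b_nonneg[of \<omega>] by (simp add: abs_mult)
    qed
    thus "AE \<omega> in M. norm (b \<omega> * env (xbar k \<omega>)) \<le> norm (b \<omega> * (\<bar>l\<bar> + \<bar>f y\<bar>) + 1 / (2 * t) * (b \<omega> * (norm (xbar k \<omega> - y))\<^sup>2))"
      by (intro AE_I2)
  qed measurable
qed

text \<open>The Lyapunov function, the quantity to be made small, and the mean consensus error.\<close>

abbreviation "\<Phi> k \<equiv> \<integral>\<omega>. b \<omega> * env (xbar k \<omega>) \<partial>M"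
abbreviation "D k \<equiv> \<integral>\<omega>. b \<omega> * (d k \<omega>)\<^sup>2 \<partial>M"
abbreviation "u k \<equiv> \<integral>\<omega>. b \<omega> * disp k \<omega> \<partial>M"

lemma integrable_disp: "integrable M (\<lambda>\<omega>. b \<omega> * disp k \<omega>)"
  by (rule integrable_dispersion[OF sq_integrable_x])

lemma integrable_d: "integrable M (\<lambda>\<omega>. b \<omega> * (d k \<omega>)\<^sup>2)"
  using sq_integrable_d[of k] by (simp add: sq_integrable_def)

lemma u_nonneg: "u k \<ge> 0"
  by (intro integral_nonneg_AE AE_I2 mult_nonneg_nonneg b_nonneg dispersion_nonneg)

lemma \<Phi>_bounded_below: "\<exists>l. \<forall>k. \<Phi> k \<ge> l"
proof -
  obtain l where l: "\<And>y. l \<le> f y" using bdd_below_f by (auto simp: bdd_below_def)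
  have "\<Phi> k \<ge> - \<bar>l\<bar>" for k
  proof (rule integral_ge_const[OF integrable_env], rule AE_I2)
    fix \<omega>
    have "env (xbar k \<omega>) \<ge> - \<bar>l\<bar>"
      using l[of "p k \<omega>"] t_pos by (simp add: env_eq prox_objective_def add_increasing2)
    hence "b \<omega> * env (xbar k \<omega>) \<ge> b \<omega> * - \<bar>l\<bar>" by (intro mult_left_mono b_nonneg)
    moreover have "b \<omega> * \<bar>l\<bar> \<le> \<bar>l\<bar>" using b_le_1[of \<omega>] b_nonneg[of \<omega>] by (intro mult_left_le_one_le) auto
    ultimately show "- \<bar>l\<bar> \<le> b \<omega> * env (xbar k \<omega>)" by simp
  qed
  thus ?thesis by blast
qed

lemma expected_inner_le:
  "\<alpha> k / real CARD('v) * (\<Sum>i\<in>UNIV. \<integral>\<omega>. b \<omega> * ((p k \<omega> - v i k \<omega>) \<bullet> \<xi> i k \<omega>) \<partial>M)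
    \<le> - ((1 / t - \<rho>) / 2) * \<alpha> k * D k + (\<alpha> k)\<^sup>2 * L\<^sup>2 / 2 + (1 / 2 + \<rho> * \<alpha> k) / real CARD('v) * u k"
proof -
  let ?G = "\<lambda>i. vec_cond_exp M (F k) (\<xi> i k)"
  let ?\<kappa> = "(1 / t - \<rho>) / 2" and ?c = "(1 / 2 + \<rho> * \<alpha> k) / real CARD('v)"
  have adapted: "(\<lambda>\<omega>. p k \<omega> - v i k \<omega>) \<in> borel_measurable (F k)" for i
    using p_adapted v_adapted by (rule borel_measurable_diff)
  note ce = integral_inner_vec_cond_exp[OF subalgebra_F b_adapted adapted sq_integrable_p_v sq_integrable_\<xi>]
  have const: "integrable M (\<lambda>\<omega>. b \<omega> * c)" for c
    by (rule integrable_weighted_bounded[of "\<lambda>_. c" "\<bar>c\<bar>"]) auto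
  have "\<alpha> k / real CARD('v) * (\<Sum>i\<in>UNIV. \<integral>\<omega>. b \<omega> * ((p k \<omega> - v i k \<omega>) \<bullet> \<xi> i k \<omega>) \<partial>M)
      = \<alpha> k / real CARD('v) * (\<Sum>i\<in>UNIV. \<integral>\<omega>. b \<omega> * ((p k \<omega> - v i k \<omega>) \<bullet> ?G i \<omega>) \<partial>M)"
    by (simp only: ce(2))
  also have "\<dots> = (\<integral>\<omega>. \<alpha> k / real CARD('v) * (\<Sum>i\<in>UNIV. b \<omega> * ((p k \<omega> - v i k \<omega>) \<bullet> ?G i \<omega>)) \<partial>M)"
    by (simp only: Bochner_Integration.integral_sum[OF ce(1)] integral_mult_right_zero)
  also have "\<dots> \<le> (\<integral>\<omega>. - ?\<kappa> * \<alpha> k * (b \<omega> * (d k \<omega>)\<^sup>2) + (\<alpha> k)\<^sup>2 * L\<^sup>2 / 2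
      + ?c * (b \<omega> * disp k \<omega>) \<partial>M)"
  proof (rule integral_mono_AE)
    show "integrable M (\<lambda>\<omega>. \<alpha> k / real CARD('v) * (\<Sum>i\<in>UNIV. b \<omega> * ((p k \<omega> - v i k \<omega>) \<bullet> ?G i \<omega>)))"
      by (intro integrable_mult_right Bochner_Integration.integrable_sum ce(1))
    show "integrable M (\<lambda>\<omega>. - ?\<kappa> * \<alpha> k * (b \<omega> * (d k \<omega>)\<^sup>2) + (\<alpha> k)\<^sup>2 * L\<^sup>2 / 2
        + ?c * (b \<omega> * disp k \<omega>))"
      by (intro Bochner_Integration.integrable_add integrable_mult_right integrable_d integrable_disp
          integrable_const)
    have "AE \<omega> in M. \<forall>i\<in>UNIV. ?G i \<omega> \<in> subdifferential \<rho> (fi i) (v i k \<omega>)"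
      using \<xi>_subgradient by (intro AE_finite_allI) auto
    thus "AE \<omega> in M. \<alpha> k / real CARD('v) * (\<Sum>i\<in>UNIV. b \<omega> * ((p k \<omega> - v i k \<omega>) \<bullet> ?G i \<omega>))
      \<le> - ?\<kappa> * \<alpha> k * (b \<omega> * (d k \<omega>)\<^sup>2) + (\<alpha> k)\<^sup>2 * L\<^sup>2 / 2 + ?c * (b \<omega> * disp k \<omega>)"
    proof (rule AE_mp, intro AE_I2 impI)
      fix \<omega> assume \<omega>: "\<omega> \<in> space M" and g: "\<forall>i\<in>UNIV. ?G i \<omega> \<in> subdifferential \<rho> (fi i) (v i k \<omega>)"
      have "\<alpha> k / real CARD('v) * (\<Sum>i\<in>UNIV. b \<omega> * ((p k \<omega> - v i k \<omega>) \<bullet> ?G i \<omega>))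
          = b \<omega> * (\<alpha> k / real CARD('v) * (\<Sum>i\<in>UNIV. (p k \<omega> - v i k \<omega>) \<bullet> ?G i \<omega>))"
        by (simp flip: sum_distrib_left)
      also have "\<dots> \<le> b \<omega> * (- ?\<kappa> * \<alpha> k * (d k \<omega>)\<^sup>2 + (\<alpha> k)\<^sup>2 * L\<^sup>2 / 2 + ?c * disp k \<omega>)"
        by (intro mult_left_mono b_nonneg subgradient_inner_le \<omega>) (use g in auto)
      also have "\<dots> = - ?\<kappa> * \<alpha> k * (b \<omega> * (d k \<omega>)\<^sup>2) + b \<omega> * ((\<alpha> k)\<^sup>2 * L\<^sup>2 / 2) + ?c * (b \<omega> * disp k \<omega>)"
        by (simp only: distrib_left mult.assoc mult.left_commute)
      also have "b \<omega> * ((\<alpha> k)\<^sup>2 * L\<^sup>2 / 2) \<le> (\<alpha> k)\<^sup>2 * L\<^sup>2 / 2"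
        using b_le_1[of \<omega>] b_nonneg[of \<omega>] by (intro mult_left_le_one_le) auto
      finally show "\<alpha> k / real CARD('v) * (\<Sum>i\<in>UNIV. b \<omega> * ((p k \<omega> - v i k \<omega>) \<bullet> ?G i \<omega>))
        \<le> - ?\<kappa> * \<alpha> k * (b \<omega> * (d k \<omega>)\<^sup>2) + (\<alpha> k)\<^sup>2 * L\<^sup>2 / 2 + ?c * (b \<omega> * disp k \<omega>)" by simp
    qed
  qed
  also have "\<dots> = - ?\<kappa> * \<alpha> k * D k + (\<alpha> k)\<^sup>2 * L\<^sup>2 / 2 + ?c * u k"
    using integrable_d[of k] integrable_disp[of k] by (simp add: prob_space)
  finally show ?thesis .
qed

lemma expected_descent:
  "\<Phi> (Suc k) \<le> \<Phi> k - (1 / t - \<rho>) / (2 * t) * \<alpha> k * D k + (1 + \<rho> * \<alpha> k) / (t * real CARD('v)) * u k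
    + L\<^sup>2 / t * (\<alpha> k)\<^sup>2"
proof -
  have int1: "integrable M (\<lambda>\<omega>. b \<omega> * ((p k \<omega> - v i k \<omega>) \<bullet> \<xi> i k \<omega>))" for i
    by (intro integrable_inner sq_integrable_p_v sq_integrable_\<xi>)
  let ?S = "\<lambda>\<omega>. \<Sum>i\<in>UNIV. b \<omega> * ((p k \<omega> - v i k \<omega>) \<bullet> \<xi> i k \<omega>)"
  let ?Q = "\<lambda>\<omega>. \<Sum>i\<in>UNIV. b \<omega> * (norm (\<xi> i k \<omega>))\<^sup>2"
  have S: "integrable M ?S" "(\<integral>\<omega>. ?S \<omega> \<partial>M) = (\<Sum>i\<in>UNIV. \<integral>\<omega>. b \<omega> * ((p k \<omega> - v i k \<omega>) \<bullet> \<xi> i k \<omega>) \<partial>M)"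
    by (intro Bochner_Integration.integrable_sum Bochner_Integration.integral_sum int1)+
  have Q: "integrable M ?Q" "(\<integral>\<omega>. ?Q \<omega> \<partial>M) = (\<Sum>i\<in>UNIV. \<integral>\<omega>. b \<omega> * (norm (\<xi> i k \<omega>))\<^sup>2 \<partial>M)"
    by (intro Bochner_Integration.integrable_sum Bochner_Integration.integral_sum \<xi>_weighted)+
  let ?R = "\<lambda>\<omega>. b \<omega> * env (xbar k \<omega>) + 1 / (2 * t * real CARD('v)) * (b \<omega> * disp k \<omega>)
      + \<alpha> k / (t * real CARD('v)) * ?S \<omega> + (\<alpha> k)\<^sup>2 / (2 * t * real CARD('v)) * ?Q \<omega>"
  have "\<Phi> (Suc k) \<le> (\<integral>\<omega>. ?R \<omega> \<partial>M)"
  proof (rule integral_mono)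
    show "integrable M ?R"
      by (intro Bochner_Integration.integrable_add integrable_mult_right integrable_env integrable_disp S(1) Q(1))
    fix \<omega> assume "\<omega> \<in> space M"
    from mult_left_mono[OF env_step[OF this, of k] b_nonneg[of \<omega>]]
    show "b \<omega> * env (xbar (Suc k) \<omega>) \<le> ?R \<omega>"
      by (simp add: distrib_left sum_distrib_left[symmetric] mult.left_commute)
  qed (rule integrable_env)
  also have "\<dots> = \<Phi> k + 1 / (2 * t * real CARD('v)) * u k + \<alpha> k / (t * real CARD('v)) * (\<integral>\<omega>. ?S \<omega> \<partial>M)
      + (\<alpha> k)\<^sup>2 / (2 * t * real CARD('v)) * (\<integral>\<omega>. ?Q \<omega> \<partial>M)"
    by (simp only: Bochner_Integration.integral_add integral_mult_right_zero
        Bochner_Integration.integrable_add integrable_mult_right integrable_env integrable_disp S(1) Q(1))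
  also have "\<alpha> k / (t * real CARD('v)) * (\<integral>\<omega>. ?S \<omega> \<partial>M) = 1 / t * (\<alpha> k / real CARD('v) * (\<integral>\<omega>. ?S \<omega> \<partial>M))" by simp
  also have "\<dots> \<le> 1 / t * (- ((1 / t - \<rho>) / 2) * \<alpha> k * D k + (\<alpha> k)\<^sup>2 * L\<^sup>2 / 2 + (1 / 2 + \<rho> * \<alpha> k) / real CARD('v) * u k)"
    unfolding S(2) using t_pos by (intro mult_left_mono expected_inner_le) auto
  also have "(\<integral>\<omega>. ?Q \<omega> \<partial>M) \<le> real CARD('v) * L\<^sup>2"
    unfolding Q(2) by (rule order_trans[OF sum_mono[OF \<xi>_weighted(2)]]) simp
  hence "(\<alpha> k)\<^sup>2 / (2 * t * real CARD('v)) * (\<integral>\<omega>. ?Q \<omega> \<partial>M) \<le> (\<alpha> k)\<^sup>2 / (2 * t * real CARD('v)) * (real CARD('v) * L\<^sup>2)"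
    using t_pos by (intro mult_left_mono) auto
  finally have "\<Phi> (Suc k) \<le> \<Phi> k + 1 / (2 * t * real CARD('v)) * u k
     + 1 / t * (- ((1 / t - \<rho>) / 2) * \<alpha> k * D k + (\<alpha> k)\<^sup>2 * L\<^sup>2 / 2 + (1 / 2 + \<rho> * \<alpha> k) / real CARD('v) * u k)
     + (\<alpha> k)\<^sup>2 / (2 * t * real CARD('v)) * (real CARD('v) * L\<^sup>2)" by simp
  also have "\<dots> = \<Phi> k - (1 / t - \<rho>) / (2 * t) * \<alpha> k * D k + (1 + \<rho> * \<alpha> k) / (t * real CARD('v)) * u k
    + L\<^sup>2 / t * (\<alpha> k)\<^sup>2"
  proof -
    define \<tau> where "\<tau> = 1 / t"
    have tn: "1 / (2 * t * real CARD('v)) = \<tau> / 2 / real CARD('v)" "(\<alpha> k)\<^sup>2 / (2 * t * real CARD('v)) * (real CARD('v) * L\<^sup>2) = \<tau> / 2 * (\<alpha> k)\<^sup>2 * L\<^sup>2"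
      "(1 / t - \<rho>) / (2 * t) = (\<tau> - \<rho>) / 2 * \<tau>" "(1 + \<rho> * \<alpha> k) / (t * real CARD('v)) = (1 + \<rho> * \<alpha> k) * \<tau> / real CARD('v)"
      "L\<^sup>2 / t = \<tau> * L\<^sup>2" by (simp_all add: \<tau>_def)
    show ?thesis unfolding tn unfolding \<tau>_def[symmetric]
      by (simp add: add_divide_distrib diff_divide_distrib algebra_simps)
  qed
  finally show ?thesis .
qed

text \<open>The perturbation of the averaging is the displacement of the mixed point in a step, whose
  mean square is at most \<open>(\<alpha> k)\<^sup>2 * L\<^sup>2\<close> for each agent.\<close>

lemma expected_consensus:
  assumes C: "C \<ge> 0"
    and contract: "\<And>(z :: nat \<Rightarrow> 'v \<Rightarrow> 'a) e k.
      (\<And>k i. z (Suc k) i = (\<Sum>j\<in>UNIV. A k i j *\<^sub>R z k j) + e k i) \<Longrightarrow>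
      dispersion (z (k + m))
        \<le> q * dispersion (z k) + C * (\<Sum>s<m. \<Sum>i\<in>UNIV. (norm (e (k + s) i))\<^sup>2)"
  shows "u (k + m) \<le> q * u k + C * real CARD('v) * L\<^sup>2 * (\<Sum>s<m. (\<alpha> (k + s))\<^sup>2)"
proof -
  let ?E = "\<lambda>\<omega>. \<Sum>s<m. (\<alpha> (k + s))\<^sup>2 * (\<Sum>i\<in>UNIV. b \<omega> * (norm (\<xi> i (k + s) \<omega>))\<^sup>2)"
  have intS: "integrable M (\<lambda>\<omega>. \<Sum>i\<in>UNIV. b \<omega> * (norm (\<xi> i l \<omega>))\<^sup>2)" for l
    by (intro Bochner_Integration.integrable_sum \<xi>_weighted)
  have intE: "integrable M ?E"
    by (intro Bochner_Integration.integrable_sum integrable_mult_right intS)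
  have "u (k + m) \<le> (\<integral>\<omega>. q * (b \<omega> * disp k \<omega>) + C * ?E \<omega> \<partial>M)"
  proof (rule integral_mono[OF integrable_disp])
    show "integrable M (\<lambda>\<omega>. q * (b \<omega> * disp k \<omega>) + C * ?E \<omega>)"
      by (intro Bochner_Integration.integrable_add integrable_mult_right integrable_disp intE)
    fix \<omega> assume \<omega>: "\<omega> \<in> space M"
    let ?e = "\<lambda>k i. x i (Suc k) \<omega> - v i k \<omega>"
    have "disp (k + m) \<omega> \<le> q * disp k \<omega> + C * (\<Sum>s<m. \<Sum>i\<in>UNIV. (norm (?e (k + s) i))\<^sup>2)"
      by (rule contract[of "\<lambda>k i. x i k \<omega>" ?e]) simp
    also have "(\<Sum>s<m. \<Sum>i\<in>UNIV. (norm (?e (k + s) i))\<^sup>2)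
        \<le> (\<Sum>s<m. \<Sum>i\<in>UNIV. (\<alpha> (k + s) * norm (\<xi> i (k + s) \<omega>))\<^sup>2)"
      by (intro sum_mono power_mono x_Suc_near \<omega> norm_ge_zero)
    also have "\<dots> = (\<Sum>s<m. (\<alpha> (k + s))\<^sup>2 * (\<Sum>i\<in>UNIV. (norm (\<xi> i (k + s) \<omega>))\<^sup>2))"
      by (simp add: power_mult_distrib sum_distrib_left)
    finally have "disp (k + m) \<omega> \<le> q * disp k \<omega>
        + C * (\<Sum>s<m. (\<alpha> (k + s))\<^sup>2 * (\<Sum>i\<in>UNIV. (norm (\<xi> i (k + s) \<omega>))\<^sup>2))"
      using C by (simp add: mult_left_mono)
    from mult_left_mono[OF this b_nonneg[of \<omega>]]
    have "b \<omega> * disp (k + m) \<omega> \<le> q * (b \<omega> * disp k \<omega>)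
        + C * (b \<omega> * (\<Sum>s<m. (\<alpha> (k + s))\<^sup>2 * (\<Sum>i\<in>UNIV. (norm (\<xi> i (k + s) \<omega>))\<^sup>2)))"
      by (simp only: distrib_left mult.left_commute)
    also have "b \<omega> * (\<Sum>s<m. (\<alpha> (k + s))\<^sup>2 * (\<Sum>i\<in>UNIV. (norm (\<xi> i (k + s) \<omega>))\<^sup>2)) = ?E \<omega>"
      by (simp add: sum_distrib_left mult.left_commute)
    finally show "b \<omega> * disp (k + m) \<omega> \<le> q * (b \<omega> * disp k \<omega>) + C * ?E \<omega>" .
  qed
  also have "\<dots> = q * u k + C * (\<integral>\<omega>. ?E \<omega> \<partial>M)"
    by (simp only: Bochner_Integration.integral_add integral_mult_right_zero
        integrable_mult_right integrable_disp intE)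
  finally have *: "u (k + m) \<le> q * u k + C * (\<integral>\<omega>. ?E \<omega> \<partial>M)" .
  have "(\<integral>\<omega>. ?E \<omega> \<partial>M) = (\<Sum>s<m. (\<alpha> (k + s))\<^sup>2 * (\<Sum>i\<in>UNIV. \<integral>\<omega>. b \<omega> * (norm (\<xi> i (k + s) \<omega>))\<^sup>2 \<partial>M))"
    by (simp only: Bochner_Integration.integral_sum integral_mult_right_zero
        integrable_mult_right intS \<xi>_weighted(1))
  also have "\<dots> \<le> (\<Sum>s<m. (\<alpha> (k + s))\<^sup>2 * (real CARD('v) * L\<^sup>2))"
  proof (intro sum_mono mult_left_mono)
    fix s show "(\<Sum>i\<in>UNIV. \<integral>\<omega>. b \<omega> * (norm (\<xi> i (k + s) \<omega>))\<^sup>2 \<partial>M) \<le> real CARD('v) * L\<^sup>2"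
      by (rule order_trans[OF sum_mono[OF \<xi>_weighted(2)]]) simp
  qed simp
  also have "\<dots> = real CARD('v) * L\<^sup>2 * (\<Sum>s<m. (\<alpha> (k + s))\<^sup>2)"
    by (simp add: sum_distrib_left mult_ac)
  finally have "C * (\<integral>\<omega>. ?E \<omega> \<partial>M) \<le> C * (real CARD('v) * L\<^sup>2 * (\<Sum>s<m. (\<alpha> (k + s))\<^sup>2))"
    using C by (rule mult_left_mono)
  thus ?thesis using * by (simp add: mult.assoc)
qed

lemma exists_small_weighted_distance:
  assumes \<eta>: "\<eta> > 0" and diag: "\<And>k i. A k i i \<ge> \<eta>"
    and pos: "\<And>k i j. A k i j > 0 \<Longrightarrow> A k i j \<ge> \<eta>"
    and window: "\<And>e k. e \<in> E \<Longrightarrow> e \<in> (\<Union>s\<in>{k..<k + T}. edges A s)"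
    and conn: "strongly_connected E"
    and \<alpha>: "\<alpha> \<longlonglongrightarrow> 0" "filterlim (\<lambda>n. \<Sum>k<n. \<alpha> k) at_top sequentially"
    and \<epsilon>: "\<epsilon> > 0"
  shows "\<exists>k. D k < \<epsilon>"
proof (rule dispersion_perturbed_averaging[OF ds \<eta> diag pos window conn, where 'a='a])
  fix m q C
  assume mqC: "0 \<le> q" "q < 1" "0 \<le> C"
    "\<And>(z :: nat \<Rightarrow> 'v \<Rightarrow> 'a) e k.
      (\<And>k i. z (Suc k) i = (\<Sum>j\<in>UNIV. A k i j *\<^sub>R z k j) + e k i) \<Longrightarrow>
      dispersion (z (k + m))
        \<le> q * dispersion (z k) + C * (\<Sum>s<m. \<Sum>i\<in>UNIV. (norm (e (k + s) i))\<^sup>2)"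
  obtain l where l: "\<And>k. \<Phi> k \<ge> l" using \<Phi>_bounded_below by blast
  have "Bseq \<alpha>" using \<alpha>(1) by (intro convergent_imp_Bseq) (auto simp: convergent_def)
  then obtain am where "am > 0" "\<And>k. norm (\<alpha> k) \<le> am" by (auto elim: BseqE)
  hence am: "am > 0" "\<alpha> k \<le> am" for k using \<alpha>_pos[of k] by (auto simp: abs_le_iff)
  have "\<Phi> (Suc k) \<le> \<Phi> k - (1 / t - \<rho>) / (2 * t) * \<alpha> k * D k
      + (1 + \<rho> * am) / (t * real CARD('v)) * u k + L\<^sup>2 / t * (\<alpha> k)\<^sup>2" for k
  proof -
    have "(1 + \<rho> * \<alpha> k) / (t * real CARD('v)) * u k \<le> (1 + \<rho> * am) / (t * real CARD('v)) * u k"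
      using am(2)[of k] \<rho>_pos t_pos
      by (intro mult_right_mono u_nonneg divide_right_mono add_left_mono mult_left_mono) auto
    thus ?thesis using expected_descent[of k] by linarith
  qed
  thus "\<exists>k. D k < \<epsilon>"
  proof (rule descent_exists_small)
    show "u (k + m) \<le> q * u k + C * real CARD('v) * L\<^sup>2 * (\<Sum>s<m. (\<alpha> (k + s))\<^sup>2)" for k
      by (rule expected_consensus[OF mqC(3,4)])
    show "(1 / t - \<rho>) / (2 * t) > 0" using \<rho>_less t_pos by simp
    show "(1 + \<rho> * am) / (t * real CARD('v)) \<ge> 0" using am(1) \<rho>_pos t_pos by simp
    show "L\<^sup>2 / t \<ge> 0" "C * real CARD('v) * L\<^sup>2 \<ge> 0" using t_pos mqC(3) by auto
  qed (rule l u_nonneg mqC \<alpha>_pos \<alpha> \<epsilon>)+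
qed

end

section \<open>Convergence\<close>

context subgradient_method
begin

text \<open>The weight is the indicator of the event \<open>B R\<close> that all initial points have norm at
  most \<open>R\<close>. On the complement, whose probability is small for large \<open>R\<close>, the distance to the
  proximal point is still bounded by the constant \<open>c\<close>.\<close>

lemma exists_small_distance:
  assumes net: "\<eta> > 0" "\<And>k i. A k i i \<ge> \<eta>" "\<And>k i j. A k i j > 0 \<Longrightarrow> A k i j \<ge> \<eta>"
    "\<And>e k. e \<in> E \<Longrightarrow> e \<in> (\<Union>s\<in>{k..<k + T}. edges A s)" "strongly_connected E"
    and \<alpha>: "\<alpha> \<longlonglongrightarrow> 0" "filterlim (\<lambda>n. \<Sum>k<n. \<alpha> k) at_top sequentially"
    and \<epsilon>: "\<epsilon> > 0"
  shows "\<exists>k. (\<integral>\<omega>. d k \<omega> \<partial>M) < \<epsilon>"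
proof -
  define c where "c = L / ((1 / t - \<rho>) / 2)"
  have c: "c \<ge> 0" using L_nonneg \<rho>_less by (simp add: c_def)
  define B where "B = (\<lambda>R::nat. {\<omega> \<in> space M. \<forall>i\<in>UNIV. norm (x i 0 \<omega>) \<le> real R})"
  have BF: "B R \<in> sets (F 0)" for R
  proof -
    have "{\<omega> \<in> space (F 0). \<forall>i\<in>UNIV. norm (x i 0 \<omega>) \<le> real R} \<in> sets (F 0)"
      using x_adapted[of _ 0] by measurable
    thus ?thesis using filtration.space_F[OF filtration_F] by (simp add: B_def)
  qed
  have BM: "B R \<in> sets M" for R
    using BF subalgebra_F[of 0] by (auto simp: subalgebra_def)
  have "(\<lambda>R. prob (B R)) \<longlonglongrightarrow> prob (\<Union>R. B R)"
    by (rule finite_Lim_measure_incseq) (use BM in \<open>auto simp: B_def incseq_def intro: order_trans\<close>)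
  also have "(\<Union>R. B R) = space M"
  proof -
    have "\<omega> \<in> (\<Union>R. B R)" if "\<omega> \<in> space M" for \<omega>
    proof -
      obtain R where R: "real R \<ge> Max (range (\<lambda>i. norm (x i 0 \<omega>)))" using real_arch_simple by blast
      have "norm (x i 0 \<omega>) \<le> real R" for i by (rule order_trans[OF Max_ge R]) auto
      thus ?thesis using that by (auto simp: B_def)
    qed
    thus ?thesis by (auto simp: B_def)
  qed
  finally have lim: "(\<lambda>R. prob (B R)) \<longlonglongrightarrow> 1" by (simp add: prob_space)
  define \<epsilon>' where "\<epsilon>' = \<epsilon> / (4 * (c + 1))"
  have \<epsilon>': "\<epsilon>' > 0" "c * \<epsilon>' \<le> \<epsilon> / 4" using \<epsilon> c by (auto simp: \<epsilon>'_def field_simps)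
  obtain R where R: "prob (B R) > 1 - \<epsilon>'"
    using order_tendstoD(1)[OF lim, of "1 - \<epsilon>'"] \<epsilon>'(1) by (auto simp: eventually_sequentially)
  define b where "b = (indicator (B R) :: 'w \<Rightarrow> real)"
  interpret weighted_subgradient_method M X f \<rho> t fi A \<alpha> F \<xi> x L b
  proof unfold_locales
    show "b \<in> borel_measurable M" "b \<in> borel_measurable (F 0)"
      using BM[of R] BF[of R] by (auto simp: b_def)
    show "b \<omega> \<ge> 0" "b \<omega> \<le> 1" for \<omega> by (auto simp: b_def indicator_def)
    show "integrable M (\<lambda>\<omega>. b \<omega> * (norm (x i 0 \<omega>))\<^sup>2)" for i
    proof (rule integrable_const_bound[where B="(real R)\<^sup>2"])
      show "AE \<omega> in M. norm (b \<omega> * (norm (x i 0 \<omega>))\<^sup>2) \<le> (real R)\<^sup>2"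
        by (intro AE_I2) (auto simp: b_def B_def indicator_def intro: power_mono)
      show "(\<lambda>\<omega>. b \<omega> * (norm (x i 0 \<omega>))\<^sup>2) \<in> borel_measurable M"
        unfolding b_def using BM[of R] x_measurable[of i 0] by measurable
    qed
  qed
  obtain k where k: "D k < \<epsilon>\<^sup>2 / 4"
    using exists_small_weighted_distance[OF net \<alpha>, of "\<epsilon>\<^sup>2 / 4"] \<epsilon> by auto
  have le: "d k \<omega> \<le> \<epsilon> / 4 + (1 / \<epsilon>) * (b \<omega> * (d k \<omega>)\<^sup>2) + c * (1 - b \<omega>)" if \<omega>: "\<omega> \<in> space M" for \<omega>
  proof (cases "\<omega> \<in> B R")
    case True
    have "0 \<le> (d k \<omega> - \<epsilon> / 2)\<^sup>2" by simp
    hence "\<epsilon> * d k \<omega> \<le> \<epsilon>\<^sup>2 / 4 + (d k \<omega>)\<^sup>2" by (simp add: power2_eq_square algebra_simps)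
    hence "d k \<omega> \<le> \<epsilon> / 4 + (1 / \<epsilon>) * (d k \<omega>)\<^sup>2" using \<epsilon> by (simp add: field_simps power2_eq_square)
    thus ?thesis using True by (simp add: b_def)
  next
    case False
    thus ?thesis using d_bounded[OF \<omega>, of k] \<epsilon> by (simp add: b_def c_def)
  qed
  have int_b: "integrable M b"
    using BM[of R] by (simp add: b_def emeasure_eq_measure)
  have "(\<integral>\<omega>. d k \<omega> \<partial>M) \<le> (\<integral>\<omega>. \<epsilon> / 4 + (1 / \<epsilon>) * (b \<omega> * (d k \<omega>)\<^sup>2) + c * (1 - b \<omega>) \<partial>M)"
  proof (rule integral_mono)
    show "integrable M (\<lambda>\<omega>. d k \<omega>)"
      by (rule integrable_const_bound[where B=c]) (auto intro!: AE_I2 d_bounded[folded c_def])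
    show "integrable M (\<lambda>\<omega>. \<epsilon> / 4 + (1 / \<epsilon>) * (b \<omega> * (d k \<omega>)\<^sup>2) + c * (1 - b \<omega>))"
      by (intro Bochner_Integration.integrable_add integrable_mult_right integrable_d
          Bochner_Integration.integrable_diff int_b integrable_const)
  qed (rule le)
  also have "\<dots> = \<epsilon> / 4 + (1 / \<epsilon>) * D k + c * (1 - prob (B R))"
    using int_b integrable_d[of k] BM[of R]
    by (simp add: prob_space) (simp add: b_def)
  also have "\<dots> < \<epsilon> / 4 + \<epsilon> / 4 + \<epsilon> / 4"
  proof -
    have "(1 / \<epsilon>) * D k < (1 / \<epsilon>) * (\<epsilon>\<^sup>2 / 4)" using k \<epsilon> by (intro mult_strict_left_mono) auto
    also have "\<dots> = \<epsilon> / 4" using \<epsilon> by (simp add: power2_eq_square)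
    finally have "(1 / \<epsilon>) * D k < \<epsilon> / 4" .
    moreover have "c * (1 - prob (B R)) \<le> c * \<epsilon>'" using R c by (intro mult_left_mono) auto
    ultimately show ?thesis using \<epsilon>'(2) by linarith
  qed
  finally show ?thesis using \<epsilon> by (intro exI[of _ k]) linarith
qed

end

theorem mainTheorem4:
  fixes X :: "'a::euclidean_space set"
    and fi :: "'v::finite \<Rightarrow> 'a \<Rightarrow> real"
    and f :: "'a \<Rightarrow> real"
    and A :: "nat \<Rightarrow> 'v \<Rightarrow> 'v \<Rightarrow> real"
    and \<alpha> :: "nat \<Rightarrow> real"
    and M :: "'w measure"
    and F :: "nat \<Rightarrow> 'w measure"
    and \<xi> x :: "'v \<Rightarrow> nat \<Rightarrow> 'w \<Rightarrow> 'a"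
    and \<rho> L \<eta> t :: real
    and T\<^sub>0 :: nat
  assumes X: "closed X" "convex X" "X \<noteq> {}"
    and f_def: "f = (\<lambda>y. average (\<lambda>i. fi i y))"
    and prob: "prob_space M"
    and A1: "0 < \<eta>" "\<eta> < 1" "\<And>k i. A k i i \<ge> \<eta>" "\<And>k i j. A k i j > 0 \<Longrightarrow> A k i j \<ge> \<eta>"
    and A2: "\<And>k. doubly_stochastic (A k)"
    and A3: "strongly_connected (edges_inf A)"
    and A4: "T\<^sub>0 \<ge> 1" "\<And>e k. e \<in> edges_inf A \<Longrightarrow> e \<in> (\<Union>s\<in>{k..<k + T\<^sub>0}. edges A s)"
    and A5: "bdd_below (range f)" "\<rho> > 0" "\<And>i. weakly_convex \<rho> (fi i)"
      "\<And>i y g. y \<in> X \<Longrightarrow> g \<in> subdifferential \<rho> (fi i) y \<Longrightarrow> norm g \<le> L"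
    and A6: "\<And>k. \<alpha> k > 0" "filterlim (\<lambda>n. \<Sum>k<n. \<alpha> k) at_top sequentially"
      "\<alpha> \<longlonglongrightarrow> 0" "(\<lambda>k. \<alpha> (Suc k) / \<alpha> k) \<longlonglongrightarrow> 1"
    and iterates: "stochastic_subgradient_method M F X \<rho> L fi A \<alpha> \<xi> x"
    and t: "0 < t" "t < 1 / (2 * \<rho>)"
  shows "(\<lambda>T. INF k\<in>{..T}. \<integral>\<omega>. norm (gradient (moreau_envelope t (constrained_objective f X))
                                  (average (\<lambda>i. x i k \<omega>))) \<partial>M) \<longlonglongrightarrow> 0"
proof -
  have "\<rho> * t < 1" using t A5(2) by (simp add: field_simps)
  hence \<rho>t: "\<rho> < 1 / t" using t(1) by (simp add: field_simps)
  interpret subgradient_method M X f \<rho> t fi A \<alpha> F \<xi> x L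
    unfolding subgradient_method_def weakly_convex_problem_def subgradient_method_axioms_def
    using X prob A2 A5 A6(1) iterates t(1) \<rho>t weakly_convex_average[OF A5(3)]
    by (simp add: f_def)
  let ?G = "\<lambda>k. \<integral>\<omega>. norm (gradient env (xbar k \<omega>)) \<partial>M"
  have G: "?G k = 1 / t * (\<integral>\<omega>. d k \<omega> \<partial>M)" for k by (simp add: norm_gradient_env)
  have G_nonneg: "?G k \<ge> 0" for k by simp
  have bdd: "bdd_below (?G ` S)" for S by (rule bdd_belowI2[of _ 0]) simp
  show ?thesis
  proof (rule order_tendstoI)
    fix a :: real assume "a < 0"
    have "0 \<le> (INF k\<in>{..T}. ?G k)" for T by (rule cINF_greatest) auto
    thus "\<forall>\<^sub>F T in sequentially. a < (INF k\<in>{..T}. ?G k)"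
      using \<open>a < 0\<close> by (intro always_eventually allI) (rule less_le_trans)
  next
    fix a :: real assume "0 < a"
    then obtain k where "(\<integral>\<omega>. d k \<omega> \<partial>M) < t * a"
      using exists_small_distance[OF A1(1,3,4) A4(2) A3 A6(3,2), of "t * a"] t(1) by auto
    hence k: "?G k < a" unfolding G using t(1) by (simp add: field_simps)
    have "(INF k\<in>{..T}. ?G k) < a" if "T \<ge> k" for T
      using cINF_lower[OF bdd, of k "{..T}"] that k by simp
    thus "\<forall>\<^sub>F T in sequentially. (INF k\<in>{..T}. ?G k) < a"
      unfolding eventually_sequentially by blast
  qed
qed

end
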